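(* Let $\mathcal A=\mathcal B+\mathbf i\,\mathcal C\in\mathbb C^{n\times n\times p}$, where $\mathcal B$ and $\mathcal C$ are real tensors. Let $f:\mathbb R\to\mathbb R$ be a scalar function satisfying $f(0)=0$, and let $f^{\Diamond}:\mathbb C^{n\times n\times p}\to\mathbb C^{n\times n\times p}$ be the induced generalized tensor function; denote also by $f^{\Diamond}$ the generalized tensor function from $\mathbb R^{2n\times2n\times p}$ to $\mathbb R^{2n\times2n\times p}$ induced by $f$. Let $\Phi:\mathbb C^{n\times n\times p}\to\mathbb R^{2n\times2n\times p}$ be the mapping $$\Phi(\mathcal A)=\begin{bmatrix}\mathcal B&-\mathcal C\\ \mathcal C&\mathcal B\end{bmatrix}.$$ Then $f^{\Diamond}(\Phi(\mathcal A))$ is well defined and $f^{\Diamond}$ commutes with $\Phi$: $$f^{\Diamond}(\Phi(\mathcal A))=\Phi(f^{\Diamond}(\mathcal A)).$$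
   Context: T-product. For $\mathcal A\in\mathbb C^{m\times n\times p}$ with frontal slices $A^{(1)},\dots,A^{(p)}\in\mathbb C^{m\times n}$, $\mathrm{unfold}(\mathcal A)\in\mathbb C^{mp\times n}$ is the vertical stack of $A^{(1)},\dots,A^{(p)}$, $\mathrm{fold}$ is its inverse, and $\mathrm{bcirc}(\mathcal A)\in\mathbb C^{mp\times np}$ is the block circulant matrix whose $(a,b)$ block is $A^{(((a-b)\bmod p)+1)}$; $\mathrm{bcirc}^{-1}$ is the inverse of $\mathrm{bcirc}$ on its image. For $\mathcal B\in\mathbb C^{n\times s\times p}$, $\mathcal A*\mathcal B=\mathrm{fold}(\mathrm{bcirc}(\mathcal A)\,\mathrm{unfold}(\mathcal B))$. $\mathcal A^H$ is obtained by conjugate transposing each frontal slice and reversing the order of slices $2,\dots,p$. The identity tensor has first frontal slice the identity matrix and other slices zero; $\mathcal Q$ is unitary if $\mathcal Q^H*\mathcal Q=\mathcal Q*\mathcal Q^H$ is the identity tensor. Block tensors are formed slice by slice: the $k$-th frontal slice of $\Phi(\mathcal A)$ is $\begin{bmatrix}B^{(k)}&-C^{(k)}\\C^{(k)}&B^{(k)}\end{bmatrix}$. Generalized tensor function. $F_p=p^{-1/2}(\omega^{jk})_{j,k=0}^{p-1}$ with $\omega=e^{-2\pi\mathbf i/p}$. A T-SVD is $\mathcal A=\mathcal U*\mathcal S*\mathcal V^H$ with $\mathcal U,\mathcal V$ unitary, $\mathcal S$ F-diagonal (every frontal slice diagonal) and $\mathrm{bcirc}(\mathcal S)=(F_p\otimes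 I_m)\mathrm{diag}(\Sigma_1,\dots,\Sigma_p)(F_p^H\otimes I_n)$, where each $\Sigma_i\in\mathbb R^{m\times n}$ is diagonal with nonnegative entries. For a scalar function $f$, $f^{\Diamond}(\mathcal A)=\mathcal U*\hat f(\mathcal S)*\mathcal V^H$ with $\hat f(\mathcal S)=\mathrm{bcirc}^{-1}\big((F_p\otimes I_m)\mathrm{diag}(\tilde f(\Sigma_1),\dots,\tilde f(\Sigma_p))(F_p^H\otimes I_n)\big)$ and $\tilde f(\Sigma_i)=f(\sqrt{\Sigma_i\Sigma_i^H})(\sqrt{\Sigma_i\Sigma_i^H})^\dagger\Sigma_i$, i.e. $\tilde f(\Sigma_i)$ is diagonal, with $f(\sigma)$ in place of each diagonal entry $\sigma>0$ and $0$ in place of each diagonal entry $0$. *)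

theory Defs
  imports Complex_Main "Jordan_Normal_Form.Schur_Decomposition"
begin

text \<open>
  A third-order tensor of size \<open>m \<times> n \<times> p\<close> is the list of its \<open>p\<close> frontal slices.
  Slices, rows and columns are numbered from 0, so slice \<open>A\<^sup>(\<^sup>k\<^sup>)\<close> is \<open>A ! (k - 1)\<close>.
\<close>

type_synonym 'a tensor = "'a mat list"

definition carrier_tensor :: "nat \<Rightarrow> nat \<Rightarrow> nat \<Rightarrow> 'a tensor set" where
  "carrier_tensor m n p = {A. length A = p \<and> set A \<subseteq> carrier_mat m n}"

definition tnrows :: "'a tensor \<Rightarrow> nat" where
  "tnrows A = dim_row (hd A)"

definition tncols :: "'a tensor \<Rightarrow> nat" where
  "tncols A = dim_col (hd A)"

definition unfold_tensor :: "'a tensor \<Rightarrow> 'a mat" where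
  "unfold_tensor A = (let m = tnrows A; n = tncols A; p = length A in
     mat (m * p) n (\<lambda>(i, j). (A ! (i div m)) $$ (i mod m, j)))"

definition fold_tensor :: "nat \<Rightarrow> 'a mat \<Rightarrow> 'a tensor" where
  "fold_tensor p M = (let m = dim_row M div p in
     map (\<lambda>k. mat m (dim_col M) (\<lambda>(i, j). M $$ (k * m + i, j))) [0..<p])"

text \<open>
  The summand \<open>p\<close> avoids the truncated subtraction: for block indices \<open>a, b < p\<close>,
  \<open>(a + p - b) mod p\<close> is the residue of \<open>a - b\<close> modulo \<open>p\<close>.
\<close>

definition bcirc :: "'a tensor \<Rightarrow> 'a mat" where
  "bcirc A = (let m = tnrows A; n = tncols A; p = length A in
     mat (m * p) (n * p)
       (\<lambda>(i, j). (A ! ((i div m + p - j div n) mod p)) $$ (i mod m, j mod n)))"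

definition bcirc_inv :: "nat \<Rightarrow> nat \<Rightarrow> nat \<Rightarrow> 'a mat \<Rightarrow> 'a tensor" where
  "bcirc_inv m n p = inv_into (carrier_tensor m n p) bcirc"

definition tprod :: "'a::semiring_0 tensor \<Rightarrow> 'a tensor \<Rightarrow> 'a tensor" (infixl "\<star>" 70) where
  "A \<star> B = fold_tensor (length A) (bcirc A * unfold_tensor B)"

definition tadjoint :: "complex tensor \<Rightarrow> complex tensor" where
  "tadjoint A = (let p = length A in map (\<lambda>k. mat_adjoint (A ! ((p - k) mod p))) [0..<p])"

definition tid :: "nat \<Rightarrow> nat \<Rightarrow> complex tensor" where
  "tid n p = map (\<lambda>k. if k = 0 then 1\<^sub>m n else 0\<^sub>m n n) [0..<p]"

definition tunitary :: "nat \<Rightarrow> nat \<Rightarrow> complex tensor \<Rightarrow> bool" where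
  "tunitary n p Q \<longleftrightarrow> Q \<in> carrier_tensor n n p \<and>
     tadjoint Q \<star> Q = tid n p \<and> Q \<star> tadjoint Q = tid n p"

definition F_diagonal :: "'a::zero tensor \<Rightarrow> bool" where
  "F_diagonal S \<longleftrightarrow> (\<forall>M\<in>set S. diagonal_mat M)"

definition kronecker :: "'a::semiring_0 mat \<Rightarrow> 'a mat \<Rightarrow> 'a mat" where
  "kronecker A B = mat (dim_row A * dim_row B) (dim_col A * dim_col B)
     (\<lambda>(i, j). A $$ (i div dim_row B, j div dim_col B) * B $$ (i mod dim_row B, j mod dim_col B))"

definition fourier_mat :: "nat \<Rightarrow> complex mat" where
  "fourier_mat p = mat p p (\<lambda>(j, k). cis (- 2 * pi / real p) ^ (j * k) / complex_of_real (sqrt (real p)))"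

definition fourier_block_diag :: "nat \<Rightarrow> nat \<Rightarrow> real mat list \<Rightarrow> complex mat" where
  "fourier_block_diag m n Ds = (let F = fourier_mat (length Ds) in
     kronecker F (1\<^sub>m m) * diag_block_mat (map (map_mat complex_of_real) Ds)
       * kronecker (mat_adjoint F) (1\<^sub>m n))"

text \<open>
  \<open>is_tsvd A U S V Ds\<close>: \<open>A = U \<star> S \<star> V\<^sup>H\<close> is a T-SVD whose Fourier-domain blocks are
  \<open>Ds = [\<Sigma>\<^sub>1, \<dots>, \<Sigma>\<^sub>p]\<close>. No order is imposed on the singular values.
\<close>

definition is_tsvd ::
  "complex tensor \<Rightarrow> complex tensor \<Rightarrow> complex tensor \<Rightarrow> complex tensor \<Rightarrow> real mat list \<Rightarrow> bool" where
  "is_tsvd A U S V Ds \<longleftrightarrow> (let m = tnrows A; n = tncols A; p = length A in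
     tunitary m p U \<and> tunitary n p V \<and> S \<in> carrier_tensor m n p \<and> F_diagonal S \<and>
     A = U \<star> S \<star> tadjoint V \<and>
     length Ds = p \<and>
     (\<forall>D\<in>set Ds. D \<in> carrier_mat m n \<and> diagonal_mat D \<and> (\<forall>i<m. \<forall>j<n. 0 \<le> D $$ (i, j))) \<and>
     bcirc S = fourier_block_diag m n Ds)"

text \<open>
  For \<open>D\<close> diagonal with nonnegative entries, \<open>D D\<^sup>H\<close> is diagonal, and
  \<open>f(\<surd>(D D\<^sup>H)) (\<surd>(D D\<^sup>H))\<^sup>\<dagger> D\<close> acts entrywise as below; the off-diagonal zeros stay zero.
\<close>

definition ftilde :: "(real \<Rightarrow> real) \<Rightarrow> real mat \<Rightarrow> real mat" where
  "ftilde f D = map_mat (\<lambda>\<sigma>. if \<sigma> > 0 then f \<sigma> else 0) D"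

definition fhat :: "(real \<Rightarrow> real) \<Rightarrow> nat \<Rightarrow> nat \<Rightarrow> real mat list \<Rightarrow> complex tensor" where
  "fhat f m n Ds = bcirc_inv m n (length Ds) (fourier_block_diag m n (map (ftilde f) Ds))"

text \<open>
  \<open>gtf_value f A X\<close>: some T-SVD of \<open>A\<close> yields the value \<open>X\<close>. The function is well defined at \<open>A\<close>
  if a T-SVD of \<open>A\<close> exists and all of them yield the same value.
\<close>

definition gtf_value :: "(real \<Rightarrow> real) \<Rightarrow> complex tensor \<Rightarrow> complex tensor \<Rightarrow> bool" where
  "gtf_value f A X \<longleftrightarrow> (\<exists>U S V Ds. is_tsvd A U S V Ds \<and>
     X = U \<star> fhat f (tnrows A) (tncols A) Ds \<star> tadjoint V)"

definition gtf_well_defined :: "(real \<Rightarrow> real) \<Rightarrow> complex tensor \<Rightarrow> bool" where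
  "gtf_well_defined f A \<longleftrightarrow> (\<exists>!X. gtf_value f A X)"

definition gtf :: "(real \<Rightarrow> real) \<Rightarrow> complex tensor \<Rightarrow> complex tensor" where
  "gtf f A = (THE X. gtf_value f A X)"

definition tensor_of_real :: "real tensor \<Rightarrow> complex tensor" where
  "tensor_of_real = map (map_mat complex_of_real)"

text \<open>
  On real tensors the function is taken through the embedding into complex tensors, and it is a
  well-defined function into real tensors only if the common value of all complex T-SVDs is real.
\<close>

definition gtf_real_well_defined :: "(real \<Rightarrow> real) \<Rightarrow> real tensor \<Rightarrow> bool" where
  "gtf_real_well_defined f X \<longleftrightarrow> gtf_well_defined f (tensor_of_real X) \<and>
     (\<forall>Z. gtf_value f (tensor_of_real X) Z \<longrightarrow> Z \<in> range tensor_of_real)"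

definition gtf_real :: "(real \<Rightarrow> real) \<Rightarrow> real tensor \<Rightarrow> real tensor" where
  "gtf_real f X = (THE Y. gtf_value f (tensor_of_real X) (tensor_of_real Y))"

definition cart_tensor :: "real tensor \<Rightarrow> real tensor \<Rightarrow> complex tensor" where
  "cart_tensor B C = map2 (\<lambda>M N. map_mat complex_of_real M + \<i> \<cdot>\<^sub>m map_mat complex_of_real N) B C"

definition block_tensor :: "real tensor \<Rightarrow> real tensor \<Rightarrow> real tensor" where
  "block_tensor B C = map2 (\<lambda>M N. four_block_mat M (- N) N M) B C"

definition Phi :: "complex tensor \<Rightarrow> real tensor" where
  "Phi A = block_tensor (map (map_mat Re) A) (map (map_mat Im) A)"

lemma Phi_cart_tensor:
  assumes "B \<in> carrier_tensor m n p" "C \<in> carrier_tensor m n p"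
  shows "Phi (cart_tensor B C) = block_tensor B C"
proof -
  have len: "length B = p" "length C = p" and
    dims: "\<And>k. k < p \<Longrightarrow> B ! k \<in> carrier_mat m n \<and> C ! k \<in> carrier_mat m n"
    using assms unfolding carrier_tensor_def by auto
  have "map_mat Re (map_mat complex_of_real M + \<i> \<cdot>\<^sub>m map_mat complex_of_real N) = M"
       "map_mat Im (map_mat complex_of_real M + \<i> \<cdot>\<^sub>m map_mat complex_of_real N) = N"
    if "M \<in> carrier_mat m n" "N \<in> carrier_mat m n" for M N
    using that by (auto intro!: eq_matI)
  hence "map (map_mat Re) (cart_tensor B C) = B" "map (map_mat Im) (cart_tensor B C) = C"
    using len dims by (auto simp: cart_tensor_def intro!: nth_equalityI)
  thus ?thesis by (simp add: Phi_def)
qed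

lemma Phi_carrier:
  assumes "A \<in> carrier_tensor m n p"
  shows "Phi A \<in> carrier_tensor (2 * m) (2 * n) p"
proof -
  have "four_block_mat (map_mat Re M) (- map_mat Im M) (map_mat Im M) (map_mat Re M)
      \<in> carrier_mat (2 * m) (2 * n)" if "M \<in> carrier_mat m n" for M :: "complex mat"
    using that by (auto simp: mult_2)
  thus ?thesis
    using assms by (auto simp: carrier_tensor_def Phi_def block_tensor_def set_zip subset_iff)
qed

lemma tnrows_carrier: "A \<in> carrier_tensor m n p \<Longrightarrow> 0 < p \<Longrightarrow> tnrows A = m"
  and tncols_carrier: "A \<in> carrier_tensor m n p \<Longrightarrow> 0 < p \<Longrightarrow> tncols A = n"
  by (cases A; auto simp: carrier_tensor_def tnrows_def tncols_def)+

lemma fold_unfold_tensor: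
  assumes A: "A \<in> carrier_tensor m n p" and p: "0 < p"
  shows "fold_tensor p (unfold_tensor A) = A"
proof -
  have len: "length A = p" and dims: "\<And>k. k < p \<Longrightarrow> A ! k \<in> carrier_mat m n"
    using A unfolding carrier_tensor_def by auto
  have lt: "k * m + i < m * p" if "k < p" "i < m" for k i
  proof -
    have "k * m + i < Suc k * m" using that by simp
    also have "\<dots> \<le> p * m" using that by (intro mult_le_mono1) simp
    finally show ?thesis by (simp add: mult.commute)
  qed
  note sz = tnrows_carrier[OF A p] tncols_carrier[OF A p]
  have "fold_tensor p (unfold_tensor A) ! k = A ! k" if k: "k < p" for k
  proof (rule eq_matI)
    show "dim_row (fold_tensor p (unfold_tensor A) ! k) = dim_row (A ! k)"
      "dim_col (fold_tensor p (unfold_tensor A) ! k) = dim_col (A ! k)"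
      using dims[OF k] k p len sz by (auto simp: fold_tensor_def unfold_tensor_def Let_def)
    show "fold_tensor p (unfold_tensor A) ! k $$ (i, j) = A ! k $$ (i, j)"
      if "i < dim_row (A ! k)" "j < dim_col (A ! k)" for i j
      using that dims[OF k] k p len sz lt[OF k, of i]
      by (auto simp: fold_tensor_def unfold_tensor_def Let_def)
  qed
  thus ?thesis
    using len by (intro nth_equalityI) (auto simp: fold_tensor_def Let_def)
qed

lemma bcirc_inj_on:
  assumes p: "0 < p"
  shows "inj_on bcirc (carrier_tensor m n p)"
proof (rule inj_onI)
  fix A B :: "'a tensor"
  assume A: "A \<in> carrier_tensor m n p" and B: "B \<in> carrier_tensor m n p" and eq: "bcirc A = bcirc B"
  have len: "length A = p" "length B = p"
    and dims: "\<And>k. k < p \<Longrightarrow> A ! k \<in> carrier_mat m n \<and> B ! k \<in> carrier_mat m n"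
    using A B unfolding carrier_tensor_def by auto
  have val: "bcirc T $$ (k * m + i, j) = T ! k $$ (i, j)"
    if T: "T \<in> carrier_tensor m n p" and k: "k < p" "i < m" "j < n" for T :: "'a tensor" and k i j
  proof -
    have "k * m + i < Suc k * m" using k by simp
    also have "\<dots> \<le> p * m" using k by (intro mult_le_mono1) simp
    finally have 1: "k * m + i < m * p" by (simp add: mult.commute)
    have 2: "j < n * p" using k p by (metis less_le_trans mult.commute mult_le_mono1 nat_mult_1 One_nat_def Suc_leI)
    have "length T = p" using T by (simp add: carrier_tensor_def)
    then show ?thesis
      using k 1 2 tnrows_carrier[OF T p] tncols_carrier[OF T p] by (simp add: bcirc_def Let_def)
  qed
  have "A ! k = B ! k" if k: "k < p" for k
  proof (rule eq_matI)
    show "dim_row (A ! k) = dim_row (B ! k)" "dim_col (A ! k) = dim_col (B ! k)"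
      using dims[OF k] by auto
    show "A ! k $$ (i, j) = B ! k $$ (i, j)" if "i < dim_row (B ! k)" "j < dim_col (B ! k)" for i j
      using that dims[OF k] val[OF A k, of i j] val[OF B k, of i j] eq by auto
  qed
  thus "A = B"
    using len by (intro nth_equalityI) auto
qed

end

theory Submission
  imports Defs "Jordan_Normal_Form.Spectral_Radius"
begin

text \<open>
  Write \<open>A\<^sub>j\<close> for the discrete Fourier transform of \<open>A\<close> along the slices, at frequency \<open>j\<close>. It turns the
  T-product into the product of matrices and the T-adjoint into the conjugate transpose, so a T-SVD is
  a family of matrix SVDs \<open>A\<^sub>j = U\<^sub>j \<Sigma>\<^sub>j V\<^sub>j\<^sup>H\<close>, and its value under \<open>f\<close> has the transform
  \<open>U\<^sub>j f(\<Sigma>\<^sub>j) V\<^sub>j\<^sup>H\<close>. For matrices this value does not depend on the chosen SVD, and it is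
  compatible with unitary equivalence, block diagonal sums and complex conjugation. Finally
  \<open>\<Phi>(A)\<^sub>j\<close> is similar to the block diagonal matrix of \<open>A\<^sub>j\<close> and the conjugate of \<open>A\<^sub>-\<^sub>j\<close>, by a
  unitary that depends neither on \<open>A\<close> nor on \<open>j\<close>; hence the value for \<open>\<Phi>(A)\<close> is \<open>\<Phi>\<close> of the value
  for \<open>A\<close>.
\<close>

section \<open>Singular value decomposition of square complex matrices\<close>

text \<open>One equation is enough: a left inverse of a square matrix is also a right inverse, and
  \<open>unitary_matD\<close> supplies the second equation.\<close>

definition unitary_mat :: "nat \<Rightarrow> complex mat \<Rightarrow> bool" where
  "unitary_mat n U \<longleftrightarrow> U \<in> carrier_mat n n \<and> mat_adjoint U * U = 1\<^sub>m n"

lemma mat_adjoint_carrier[simp]: "A \<in> carrier_mat m n \<Longrightarrow> mat_adjoint A \<in> carrier_mat n m"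
  by (auto simp: mat_adjoint_def)

lemma mat_adjoint_dim[simp]:
  "dim_row (mat_adjoint A) = dim_col A" "dim_col (mat_adjoint A) = dim_row A"
  by (auto simp: mat_adjoint_def)

lemma mat_adjoint_index[simp]:
  "i < dim_col A \<Longrightarrow> j < dim_row A \<Longrightarrow> mat_adjoint A $$ (i, j) = conjugate (A $$ (j, i))"
  by (simp add: mat_adjoint_def mat_of_rows_index)

lemma mat_adjoint_adjoint[simp]: "mat_adjoint (mat_adjoint A) = (A :: complex mat)"
  by (rule eq_matI) auto

lemma mat_adjoint_mult:
  fixes A B :: "complex mat"
  assumes "A \<in> carrier_mat m n" "B \<in> carrier_mat n s"
  shows "mat_adjoint (A * B) = mat_adjoint B * mat_adjoint A"
  using assms by (intro eq_matI) (auto simp: scalar_prod_def mult.commute)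

lemma mat_adjoint_four_block:
  fixes A :: "complex mat"
  assumes "A \<in> carrier_mat n1 m1" "B \<in> carrier_mat n1 m2" "C \<in> carrier_mat n2 m1" "D \<in> carrier_mat n2 m2"
  shows "mat_adjoint (four_block_mat A B C D) =
    four_block_mat (mat_adjoint A) (mat_adjoint C) (mat_adjoint B) (mat_adjoint D)"
  using assms by (intro eq_matI) auto

lemma mat_adjoint_zero[simp]: "mat_adjoint (0\<^sub>m m n :: complex mat) = 0\<^sub>m n m"
  by (rule eq_matI) auto

lemma mat_adjoint_one[simp]: "mat_adjoint (1\<^sub>m n :: complex mat) = 1\<^sub>m n"
  by (rule eq_matI) auto

lemma mat_adjoint_of_real:
  "mat_adjoint (map_mat complex_of_real D) = map_mat complex_of_real (transpose_mat D)"
  by (rule eq_matI) auto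

lemma unitary_matD:
  assumes "unitary_mat n U"
  shows "U \<in> carrier_mat n n" "mat_adjoint U \<in> carrier_mat n n"
    "mat_adjoint U * U = 1\<^sub>m n" "U * mat_adjoint U = 1\<^sub>m n"
proof -
  show U: "U \<in> carrier_mat n n" and a: "mat_adjoint U * U = 1\<^sub>m n"
    using assms by (auto simp: unitary_mat_def)
  show A: "mat_adjoint U \<in> carrier_mat n n" using U by simp
  show "U * mat_adjoint U = 1\<^sub>m n" using mat_mult_left_right_inverse[OF A U a] .
qed

lemma mult_cancel_middle:
  assumes "A \<in> carrier_mat k m" "B \<in> carrier_mat m n" "C \<in> carrier_mat n m" "D \<in> carrier_mat m l"
    and "B * C = 1\<^sub>m m"
  shows "(A * B) * (C * D) = A * (D :: 'a :: semiring_1 mat)"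
proof -
  have "(A * B) * (C * D) = A * (B * (C * D))" using assms by (intro assoc_mult_mat) auto
  also have "B * (C * D) = (B * C) * D" using assms by (intro assoc_mult_mat[symmetric]) auto
  finally show ?thesis using assms by simp
qed

lemma unitary_mat_mult:
  assumes U: "unitary_mat n U" and V: "unitary_mat n V"
  shows "unitary_mat n (U * V)"
proof -
  note u = unitary_matD[OF U] and v = unitary_matD[OF V]
  have "mat_adjoint (U * V) * (U * V) = (mat_adjoint V * mat_adjoint U) * (U * V)"
    using u(1) v(1) by (simp add: mat_adjoint_mult)
  also have "\<dots> = 1\<^sub>m n" using mult_cancel_middle[OF v(2) u(2,1) v(1) u(3)] v by simp
  finally show ?thesis using u v by (auto simp: unitary_mat_def)
qed

lemma unitary_mat_four_block_diag:
  assumes U: "unitary_mat m U" and V: "unitary_mat n V"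
  shows "unitary_mat (m + n) (four_block_mat U (0\<^sub>m m n) (0\<^sub>m n m) V)"
  unfolding unitary_mat_def
  using unitary_matD[OF U] unitary_matD[OF V]
  by (simp add: mat_adjoint_four_block[of _ m m _ n _ n] mult_four_block_mat[of _ m m _ n _ n _ _ m _ n])

section \<open>Unit vectors, completion to a unitary matrix, singular pairs\<close>

lemma mult_adjoint_scalar_prod:
  fixes M :: "complex mat"
  assumes M: "M \<in> carrier_mat m n" and x: "x \<in> carrier_vec n" and y: "y \<in> carrier_vec m"
  shows "(M *\<^sub>v x) \<bullet>c y = x \<bullet>c (mat_adjoint M *\<^sub>v y)"
proof -
  have "(M *\<^sub>v x) \<bullet>c y = (\<Sum>i<m. \<Sum>j<n. M $$ (i, j) * x $ j * conjugate (y $ i))"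
    using M x y by (auto simp: scalar_prod_def sum_distrib_right atLeast0LessThan intro!: sum.cong)
  also have "\<dots> = (\<Sum>j<n. \<Sum>i<m. M $$ (i, j) * x $ j * conjugate (y $ i))" by (rule sum.swap)
  also have "\<dots> = x \<bullet>c (mat_adjoint M *\<^sub>v y)"
    using M x y by (auto simp: scalar_prod_def sum_distrib_left atLeast0LessThan algebra_simps intro!: sum.cong)
  finally show ?thesis .
qed

lemma cscalar_prod_self:
  assumes "v \<in> carrier_vec n"
  shows "v \<bullet>c v = complex_of_real (\<Sum>i<n. (cmod (v $ i))\<^sup>2)"
  using assms by (auto simp: scalar_prod_def atLeast0LessThan complex_norm_square simp del: of_real_power)

lemma cscalar_prod_self_pos:
  fixes v :: "complex vec"
  assumes v: "v \<in> carrier_vec n" and "v \<noteq> 0\<^sub>v n"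
  obtains s :: real where "0 < s" "v \<bullet>c v = of_real s"
proof -
  have "v \<bullet>c v \<noteq> 0" using assms by simp
  moreover have "0 \<le> (\<Sum>i<n. (cmod (v $ i))\<^sup>2)" by (intro sum_nonneg) simp
  ultimately show ?thesis using that cscalar_prod_self[OF v] by (metis less_eq_real_def of_real_0)
qed

lemma cscalar_prod_smult_self:
  fixes v :: "complex vec"
  assumes "v \<in> carrier_vec n"
  shows "(c \<cdot>\<^sub>v v) \<bullet>c (c \<cdot>\<^sub>v v) = of_real ((cmod c)\<^sup>2) * (v \<bullet>c v)"
proof -
  have "(c \<cdot>\<^sub>v v) \<bullet>c (c \<cdot>\<^sub>v v) = (c * cnj c) * (v \<bullet>c v)"
    using assms by (auto simp: scalar_prod_def sum_distrib_left algebra_simps intro!: sum.cong)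
  thus ?thesis by (simp add: complex_norm_square del: of_real_power)
qed

lemma normalize_vec:
  fixes v :: "complex vec"
  assumes v: "v \<in> carrier_vec n" and "v \<noteq> 0\<^sub>v n"
  obtains c where "(c \<cdot>\<^sub>v v) \<bullet>c (c \<cdot>\<^sub>v v) = 1"
proof -
  obtain s :: real where s: "0 < s" "v \<bullet>c v = of_real s" using cscalar_prod_self_pos[OF assms] .
  have "(of_real (1 / sqrt s) \<cdot>\<^sub>v v) \<bullet>c (of_real (1 / sqrt s) \<cdot>\<^sub>v v) = 1"
    unfolding cscalar_prod_smult_self[OF v] s(2) norm_of_real of_real_mult[symmetric] using s(1)
    by (simp add: power_divide)
  thus ?thesis by (rule that)
qed

lemma unitary_mat_cols:
  assumes U: "U \<in> carrier_mat n n"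
    and o: "\<And>i j. i < n \<Longrightarrow> j < n \<Longrightarrow> col U j \<bullet>c col U i = (if i = j then 1 else 0)"
  shows "unitary_mat n U"
  unfolding unitary_mat_def
proof (intro conjI eq_matI U)
  fix i j assume ij: "i < dim_row (1\<^sub>m n :: complex mat)" "j < dim_col (1\<^sub>m n :: complex mat)"
  hence "(mat_adjoint U * U) $$ (i, j) = col U j \<bullet>c col U i"
    using U by (auto simp: scalar_prod_def mult.commute)
  thus "(mat_adjoint U * U) $$ (i, j) = 1\<^sub>m n $$ (i, j)" using o ij by simp
qed (use U in auto)

text \<open>Basis completion puts \<open>v\<close> first and Gram-Schmidt leaves the first vector
  unchanged, so only the lengths of the other vectors remain to be corrected.\<close>

lemma unitary_completion:
  fixes v :: "complex vec"
  assumes v: "v \<in> carrier_vec n" and v1: "v \<bullet>c v = 1"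
  obtains U where "unitary_mat n U" "col U 0 = v"
proof -
  interpret cof_vec_space n "TYPE(complex)" .
  have v0: "v \<noteq> 0\<^sub>v n" using v1 by auto
  have n: "0 < n" using v v0 by (cases n) auto
  define b where "b = basis_completion v"
  define ws where "ws = gram_schmidt n b"
  note bc = basis_completion[OF v v0, folded b_def]
  obtain vs where bv: "b = v # vs" using bc(6,7) n by (cases b) auto
  note gs = gram_schmidt_result[OF bc(2,4,5) ws_def]
  have len: "length ws = n" using gs(4) bc(6) by simp
  have "hd ws = v" using gram_schmidt_hd[OF v, of vs] by (simp add: ws_def bv)
  hence ws0: "ws ! 0 = v" using len n by (cases ws) auto
  have ws: "ws ! i \<in> carrier_vec n" if "i < n" for i using gs(3) len that by auto
  have "\<exists>c. (c \<cdot>\<^sub>v ws ! i) \<bullet>c (c \<cdot>\<^sub>v ws ! i) = 1" if i: "i < n" for i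
  proof -
    have "ws ! i \<bullet>c ws ! i \<noteq> 0" using corthogonalD[OF gs(2)] i len by auto
    hence "ws ! i \<noteq> 0\<^sub>v n" by auto
    thus ?thesis using normalize_vec[OF ws[OF i]] by metis
  qed
  then obtain c where c: "\<And>i. i < n \<Longrightarrow> (c i \<cdot>\<^sub>v ws ! i) \<bullet>c (c i \<cdot>\<^sub>v ws ! i) = 1" by metis
  \<comment> \<open>\<open>c 0\<close> is determined only up to a phase. The factor 1 keeps column 0
    equal to \<open>v\<close> itself, which already has length 1.\<close>
  define d where "d i = (if i = 0 then 1 else c i)" for i
  have d: "(d i \<cdot>\<^sub>v ws ! i) \<bullet>c (d i \<cdot>\<^sub>v ws ! i) = 1" if "i < n" for i
    using c[OF that] ws0 v v1 by (auto simp: d_def)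
  have d': "(d j \<cdot>\<^sub>v ws ! j) \<bullet>c (d i \<cdot>\<^sub>v ws ! i) = 0" if "i < n" "j < n" "i \<noteq> j" for i j
  proof -
    have "ws ! j \<bullet>c ws ! i = 0" using corthogonalD[OF gs(2)] that len by auto
    thus ?thesis using ws[of i] ws[of j] that by (simp add: conjugate_smult_vec)
  qed
  define U where "U = mat_of_cols n (map (\<lambda>i. d i \<cdot>\<^sub>v ws ! i) [0..<n])"
  have U: "U \<in> carrier_mat n n" by (rule carrier_matI) (simp_all add: U_def)
  have col: "col U i = d i \<cdot>\<^sub>v ws ! i" if "i < n" for i
    using that ws[OF that] by (simp add: U_def)
  have "unitary_mat n U" by (rule unitary_mat_cols[OF U]) (metis col d d')
  moreover have "col U 0 = v" using col[OF n] ws0 by (simp add: d_def)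
  ultimately show ?thesis by (rule that)
qed

text \<open>
  An eigenvector \<open>v\<close> of \<open>M\<^sup>H M\<close> yields \<open>u\<close> as the normalized \<open>M v\<close>, which needs \<open>M v \<noteq> 0\<close>; for singular
  \<open>M\<close> two kernel vectors do instead.
\<close>
lemma singular_pair:
  fixes M :: "complex mat"
  assumes M: "M \<in> carrier_mat n n" and n: "0 < n"
  obtains u v and \<sigma> :: real where "u \<in> carrier_vec n" "v \<in> carrier_vec n" "u \<bullet>c u = 1" "v \<bullet>c v = 1" "0 \<le> \<sigma>"
    "M *\<^sub>v v = of_real \<sigma> \<cdot>\<^sub>v u" "mat_adjoint M *\<^sub>v u = of_real \<sigma> \<cdot>\<^sub>v v"
proof (cases "det M = 0")
  case True
  have A: "mat_adjoint M \<in> carrier_mat n n" using M by simp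
  \<comment> \<open>A right inverse of \<open>mat_adjoint M\<close> would have as its adjoint a left
    inverse of \<open>M\<close>, against \<open>det M = 0\<close>.\<close>
  have "det (mat_adjoint M) = 0"
  proof (rule ccontr)
    assume "det (mat_adjoint M) \<noteq> 0"
    then obtain B where B: "B \<in> carrier_mat n n" "mat_adjoint M * B = 1\<^sub>m n"
      using det_non_zero_imp_unit[OF A] by (auto simp: Units_def ring_mat_def)
    have "mat_adjoint (mat_adjoint M * B) = 1\<^sub>m n" using B by simp
    hence "mat_adjoint B * M = 1\<^sub>m n" using mat_adjoint_mult[OF A B(1)] by simp
    hence "det (mat_adjoint B) * det M = 1" using det_mult[of "mat_adjoint B" n M] B M by simp
    thus False using True by simp
  qed
  then obtain u where u: "u \<in> carrier_vec n" "u \<noteq> 0\<^sub>v n" "mat_adjoint M *\<^sub>v u = 0\<^sub>v n"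
    using det_0_iff_vec_prod_zero[OF A] by auto
  obtain v where v: "v \<in> carrier_vec n" "v \<noteq> 0\<^sub>v n" "M *\<^sub>v v = 0\<^sub>v n"
    using det_0_iff_vec_prod_zero[OF M] True by auto
  obtain c where c: "(c \<cdot>\<^sub>v u) \<bullet>c (c \<cdot>\<^sub>v u) = 1" using normalize_vec[OF u(1,2)] .
  obtain d where d: "(d \<cdot>\<^sub>v v) \<bullet>c (d \<cdot>\<^sub>v v) = 1" using normalize_vec[OF v(1,2)] .
  show ?thesis
    by (rule that[of "c \<cdot>\<^sub>v u" "d \<cdot>\<^sub>v v" 0])
      (use u v c d M A in \<open>auto simp: mult_mat_vec[of _ n n]\<close>)
next
  case False
  have A: "mat_adjoint M \<in> carrier_mat n n" using M by simp
  hence AM: "mat_adjoint M * M \<in> carrier_mat n n" using M by (rule mult_carrier_mat)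
  obtain e where "eigenvalue (mat_adjoint M * M) e"
    using spectrum_non_empty[OF AM n] by (auto simp: spectrum_def)
  then obtain v' where v': "v' \<in> carrier_vec n" "v' \<noteq> 0\<^sub>v n" "(mat_adjoint M * M) *\<^sub>v v' = e \<cdot>\<^sub>v v'"
    using AM M by (auto simp: eigenvalue_def eigenvector_def)
  obtain c where c: "(c \<cdot>\<^sub>v v') \<bullet>c (c \<cdot>\<^sub>v v') = 1" using normalize_vec[OF v'(1,2)] .
  define v where "v = c \<cdot>\<^sub>v v'"
  have v: "v \<in> carrier_vec n" "v \<bullet>c v = 1" using v' c by (auto simp: v_def)
  have ev: "mat_adjoint M *\<^sub>v (M *\<^sub>v v) = e \<cdot>\<^sub>v v"
  proof -
    have "mat_adjoint M *\<^sub>v (M *\<^sub>v v) = (mat_adjoint M * M) *\<^sub>v v"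
      using assoc_mult_mat_vec[OF A M v(1)] by simp
    also have "\<dots> = c \<cdot>\<^sub>v (e \<cdot>\<^sub>v v')"
      unfolding v_def mult_mat_vec[OF AM v'(1)] v'(3) ..
    finally show ?thesis by (simp add: v_def smult_smult_assoc mult.commute)
  qed
  have Mv: "M *\<^sub>v v \<in> carrier_vec n" using M v by simp
  have "v \<noteq> 0\<^sub>v n" using v by auto
  hence "M *\<^sub>v v \<noteq> 0\<^sub>v n" using False det_0_iff_vec_prod_zero[OF M] v by auto
  then obtain s :: real where s: "0 < s" "(M *\<^sub>v v) \<bullet>c (M *\<^sub>v v) = of_real s"
    using cscalar_prod_self_pos[OF Mv] by blast
  \<comment> \<open>Moving \<open>M\<close> to the other side gives \<open>s\<close> as the
    conjugate of \<open>e\<close>, because the product conjugates its second argument and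
    \<open>v\<close> has length 1. Hence \<open>e\<close> is real and positive, and
    \<open>sqrt s\<close> is the singular value.\<close>
  have "of_real s = v \<bullet>c (e \<cdot>\<^sub>v v)"
    using mult_adjoint_scalar_prod[OF M v(1) Mv] s(2) ev by simp
  also have "\<dots> = cnj e" using v by (simp add: conjugate_smult_vec)
  finally have e: "e = of_real s" by (metis complex_cnj_cnj complex_cnj_complex_of_real)
  define u where "u = of_real (1 / sqrt s) \<cdot>\<^sub>v (M *\<^sub>v v)"
  have sq: "1 / sqrt s * s = sqrt s" "sqrt s * (1 / sqrt s) = 1"
    using s(1) by (simp_all add: real_div_sqrt)
  show ?thesis
  proof (rule that[of u v "sqrt s"])
    show "u \<bullet>c u = 1"
      unfolding u_def cscalar_prod_smult_self[OF Mv] s(2) norm_of_real of_real_mult[symmetric]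
      using s(1) by (simp add: power_divide)
    show "M *\<^sub>v v = of_real (sqrt s) \<cdot>\<^sub>v u"
      unfolding u_def smult_smult_assoc of_real_mult[symmetric] sq by simp
    show "mat_adjoint M *\<^sub>v u = of_real (sqrt s) \<cdot>\<^sub>v v"
      unfolding u_def mult_mat_vec[OF A Mv] ev e smult_smult_assoc of_real_mult[symmetric] sq ..
  qed (use v s Mv in \<open>auto simp: u_def\<close>)
qed

section \<open>Matrix decompositions, their block sums and their existence\<close>

definition nonneg_diag :: "nat \<Rightarrow> real mat \<Rightarrow> bool" where
  "nonneg_diag n D \<longleftrightarrow> D \<in> carrier_mat n n \<and> diagonal_mat D \<and> (\<forall>i<n. \<forall>j<n. 0 \<le> D $$ (i, j))"

text \<open>The singular values are not sorted, so a block diagonal sum of decompositions is again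
  one without any permutation.\<close>

definition is_svd :: "nat \<Rightarrow> complex mat \<Rightarrow> complex mat \<Rightarrow> real mat \<Rightarrow> complex mat \<Rightarrow> bool" where
  "is_svd n M U D V \<longleftrightarrow> unitary_mat n U \<and> unitary_mat n V \<and> nonneg_diag n D \<and>
     M = U * map_mat complex_of_real D * mat_adjoint V"

lemma nonneg_diag_four_block:
  assumes "nonneg_diag m D" "nonneg_diag n E"
  shows "nonneg_diag (m + n) (four_block_mat D (0\<^sub>m m n) (0\<^sub>m n m) E)"
  using assms by (auto simp: nonneg_diag_def diagonal_mat_def)

lemma mult_four_block_diag:
  assumes "A \<in> carrier_mat m1 k1" "D \<in> carrier_mat m2 k2"
    and "A' \<in> carrier_mat k1 l1" "D' \<in> carrier_mat k2 l2"
  shows "four_block_mat A (0\<^sub>m m1 k2) (0\<^sub>m m2 k1) D * four_block_mat A' (0\<^sub>m k1 l2) (0\<^sub>m k2 l1) D' =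
    four_block_mat (A * A') (0\<^sub>m m1 l2) (0\<^sub>m m2 l1) (D * D' :: 'a :: semiring_1 mat)"
  using assms by (simp add: mult_four_block_mat[of _ m1 k1 _ k2 _ m2 _ _ l1 _ l2])

lemma unitary_conj_eq_mat:
  assumes U: "unitary_mat n U" and V: "unitary_mat n V" and M: "M \<in> carrier_mat n n"
  shows "U * (mat_adjoint U * M * V) * mat_adjoint V = M"
proof -
  note u = unitary_matD[OF U] and v = unitary_matD[OF V]
  have "U * (mat_adjoint U * M * V) = U * (mat_adjoint U * (M * V))"
    using assoc_mult_mat[OF u(2) M v(1)] by simp
  also have "\<dots> = M * V"
    using assoc_mult_mat[OF u(1) u(2), of "M * V" n] u v M by simp
  finally show ?thesis using assoc_mult_mat[OF M v(1,2)] v(4) M by simp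
qed

lemma is_svd_four_block_diag:
  assumes M: "is_svd m M U D V" and N: "is_svd n N U' D' V'"
  shows "is_svd (m + n) (four_block_mat M (0\<^sub>m m n) (0\<^sub>m n m) N)
    (four_block_mat U (0\<^sub>m m n) (0\<^sub>m n m) U') (four_block_mat D (0\<^sub>m m n) (0\<^sub>m n m) D')
    (four_block_mat V (0\<^sub>m m n) (0\<^sub>m n m) V')"
proof -
  have c: "U \<in> carrier_mat m m" "V \<in> carrier_mat m m" "D \<in> carrier_mat m m"
    "U' \<in> carrier_mat n n" "V' \<in> carrier_mat n n" "D' \<in> carrier_mat n n"
    using M N by (auto simp: is_svd_def unitary_mat_def nonneg_diag_def)
  have z: "map_mat complex_of_real (0\<^sub>m k l) = 0\<^sub>m k l" for k l by (rule eq_matI) auto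
  have "four_block_mat U (0\<^sub>m m n) (0\<^sub>m n m) U'
      * map_mat complex_of_real (four_block_mat D (0\<^sub>m m n) (0\<^sub>m n m) D')
      * mat_adjoint (four_block_mat V (0\<^sub>m m n) (0\<^sub>m n m) V') =
    four_block_mat (U * map_mat complex_of_real D * mat_adjoint V) (0\<^sub>m m n) (0\<^sub>m n m)
      (U' * map_mat complex_of_real D' * mat_adjoint V')"
    using c by (simp add: map_four_block_mat[of _ m m _ n _ n] z mat_adjoint_four_block[of _ m m _ n _ n]
        mult_four_block_diag[of _ m m _ n n _ m _ n])
  thus ?thesis
    using M N by (auto simp: is_svd_def unitary_mat_four_block_diag nonneg_diag_four_block)
qed

lemma is_svd_conj:
  assumes M: "is_svd n M U D V" and W: "unitary_mat n W" and Z: "unitary_mat n Z"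
  shows "is_svd n (W * M * mat_adjoint Z) (W * U) D (Z * V)"
proof -
  have c: "U \<in> carrier_mat n n" "V \<in> carrier_mat n n" "map_mat complex_of_real D \<in> carrier_mat n n"
     "W \<in> carrier_mat n n" "Z \<in> carrier_mat n n"
    using M W Z by (auto simp: is_svd_def unitary_mat_def nonneg_diag_def)
  have "W * (U * map_mat complex_of_real D * mat_adjoint V) * mat_adjoint Z =
    (W * U) * map_mat complex_of_real D * mat_adjoint (Z * V)"
    using c by (simp add: mat_adjoint_mult[of _ n n _ n] assoc_mult_mat[of _ n n _ n _ n] mult_carrier_mat[of _ n n _ n])
  thus ?thesis using M W Z by (auto simp: is_svd_def unitary_mat_mult)
qed

text \<open>Deflation: with a singular pair \<open>u\<close>, \<open>v\<close> as first columns of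
  unitary matrices \<open>U\<close> and \<open>V\<close>, the matrix
  \<open>mat_adjoint U * M * V\<close> is zero in its first row and column except for the corner
  \<sigma>. The induction hypothesis decomposes the remaining block.\<close>

lemma svd_exists:
  "M \<in> carrier_mat n n \<Longrightarrow> \<exists>U D V. is_svd n M U D V"
proof (induction n arbitrary: M)
  case 0
  hence "is_svd 0 M (1\<^sub>m 0) (0\<^sub>m 0 0) (1\<^sub>m 0)"
    by (auto simp: is_svd_def unitary_mat_def nonneg_diag_def diagonal_mat_def)
  thus ?case by blast
next
  case (Suc n)
  note M = Suc.prems
  obtain u v and \<sigma> :: real where uv: "u \<in> carrier_vec (Suc n)" "v \<in> carrier_vec (Suc n)" "u \<bullet>c u = 1" "v \<bullet>c v = 1" "0 \<le> \<sigma>"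
    "M *\<^sub>v v = of_real \<sigma> \<cdot>\<^sub>v u" "mat_adjoint M *\<^sub>v u = of_real \<sigma> \<cdot>\<^sub>v v"
    using singular_pair[OF M] by blast
  obtain U where U: "unitary_mat (Suc n) U" "col U 0 = u" using unitary_completion[OF uv(1,3)] .
  obtain V where V: "unitary_mat (Suc n) V" "col V 0 = v" using unitary_completion[OF uv(2,4)] .
  note u = unitary_matD[OF U(1)] and v = unitary_matD[OF V(1)]
  define N where "N = mat_adjoint U * M * V"
  have N: "N \<in> carrier_mat (Suc n) (Suc n)" unfolding N_def by (rule mult_carrier_mat[OF mult_carrier_mat[OF u(2) M] v(1)])
  have N_col: "N $$ (i, 0) = (if i = 0 then of_real \<sigma> else 0)" if i: "i < Suc n" for i
  proof -
    have "N = mat_adjoint U * (M * V)" using assoc_mult_mat[OF u(2) M v(1)] by (simp add: N_def)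
    hence "N $$ (i, 0) = row (mat_adjoint U) i \<bullet> col (M * V) 0" using i u(1) v(1) by simp
    also have "col (M * V) 0 = of_real \<sigma> \<cdot>\<^sub>v col U 0"
      using col_mult2[OF M v(1), of 0] uv(6) by (simp add: U(2) V(2))
    also have "row (mat_adjoint U) i \<bullet> (of_real \<sigma> \<cdot>\<^sub>v col U 0) = of_real \<sigma> * (mat_adjoint U * U) $$ (i, 0)"
      using i u(1) by simp
    finally show ?thesis using i by (simp add: u(3))
  qed
  \<comment> \<open>The first row is the conjugate of the first column of
    \<open>mat_adjoint N\<close>, which is computed from \<open>mat_adjoint M *\<^sub>v u\<close>
    just as the first column of \<open>N\<close> is from \<open>M *\<^sub>v v\<close>.\<close>
  have N_row: "N $$ (0, j) = (if j = 0 then of_real \<sigma> else 0)" if j: "j < Suc n" for j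
  proof -
    have "mat_adjoint N = mat_adjoint V * mat_adjoint (mat_adjoint U * M)"
      unfolding N_def by (rule mat_adjoint_mult[OF mult_carrier_mat[OF u(2) M] v(1)])
    also have "mat_adjoint (mat_adjoint U * M) = mat_adjoint M * U"
      using mat_adjoint_mult[OF u(2) M] by simp
    finally have "mat_adjoint N = mat_adjoint V * (mat_adjoint M * U)" .
    hence "mat_adjoint N $$ (j, 0) = row (mat_adjoint V) j \<bullet> col (mat_adjoint M * U) 0"
      using j u(1) v(1) by simp
    also have "col (mat_adjoint M * U) 0 = of_real \<sigma> \<cdot>\<^sub>v col V 0"
      using col_mult2[OF mat_adjoint_carrier[OF M] u(1), of 0] uv(7) by (simp add: U(2) V(2))
    also have "row (mat_adjoint V) j \<bullet> (of_real \<sigma> \<cdot>\<^sub>v col V 0) = of_real \<sigma> * (mat_adjoint V * V) $$ (j, 0)"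
      using j v(1) by simp
    finally have "cnj (N $$ (0, j)) = (if j = 0 then of_real \<sigma> else 0)" using j N by (simp add: v(3))
    thus ?thesis by (metis complex_cnj_cnj complex_cnj_complex_of_real complex_cnj_zero)
  qed
  define N' where "N' = mat n n (\<lambda>(i, j). N $$ (Suc i, Suc j))"
  define D1 where "D1 = mat 1 1 (\<lambda>_. \<sigma>)"
  have "N' \<in> carrier_mat n n" by (simp add: N'_def)
  then obtain U' D' V' where svd': "is_svd n N' U' D' V'" using Suc.IH by blast
  \<comment> \<open>The corner is its own decomposition with identity factors, because \<sigma> is
    nonnegative.\<close>
  have "is_svd 1 (map_mat complex_of_real D1) (1\<^sub>m 1) D1 (1\<^sub>m 1)"
    using uv(5) by (auto simp: is_svd_def unitary_mat_def nonneg_diag_def diagonal_mat_def D1_def)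
  from is_svd_four_block_diag[OF this svd'] obtain U2 D2 V2 where
    svd2: "is_svd (Suc n) (four_block_mat (map_mat complex_of_real D1) (0\<^sub>m 1 n) (0\<^sub>m n 1) N') U2 D2 V2" by auto
  have "N = four_block_mat (map_mat complex_of_real D1) (0\<^sub>m 1 n) (0\<^sub>m n 1) N'"
    using N N_row N_col by (intro eq_matI) (auto simp: N'_def D1_def)
  hence "is_svd (Suc n) N U2 D2 V2" using svd2 by simp
  from is_svd_conj[OF this U(1) V(1)] show ?case
    unfolding N_def unitary_conj_eq_mat[OF U(1) V(1) M] by blast
qed

section \<open>Functions of singular values\<close>

lemma mult_right_diagonal_index:
  fixes W D :: "'a :: semiring_0 mat"
  assumes "W \<in> carrier_mat m n" "D \<in> carrier_mat n n" "diagonal_mat D" "i < m" "j < n"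
  shows "(W * D) $$ (i, j) = W $$ (i, j) * D $$ (j, j)"
proof -
  have "(W * D) $$ (i, j) = (\<Sum>k = 0..<n. W $$ (i, k) * D $$ (k, j))"
    using assms by (auto simp: scalar_prod_def)
  also have "\<dots> = (\<Sum>k = 0..<n. if k = j then W $$ (i, j) * D $$ (j, j) else 0)"
    using assms by (intro sum.cong) (auto simp: diagonal_mat_def)
  finally show ?thesis using assms by simp
qed

lemma mult_left_diagonal_index:
  fixes W D :: "'a :: semiring_0 mat"
  assumes "W \<in> carrier_mat m n" "D \<in> carrier_mat m m" "diagonal_mat D" "i < m" "j < n"
  shows "(D * W) $$ (i, j) = D $$ (i, i) * W $$ (i, j)"
proof -
  have "(D * W) $$ (i, j) = (\<Sum>k = 0..<m. D $$ (i, k) * W $$ (k, j))"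
    using assms by (auto simp: scalar_prod_def)
  also have "\<dots> = (\<Sum>k = 0..<m. if k = i then D $$ (i, i) * W $$ (i, j) else 0)"
    using assms by (intro sum.cong) (auto simp: diagonal_mat_def)
  finally show ?thesis using assms by simp
qed

text \<open>Multiplication by \<open>mat_adjoint U'\<close> on the left and by \<open>V\<close> on
  the right is reversible. It leaves a relation between two unitary matrices and the middle factors,
  which for diagonal middle factors can be read entry by entry.\<close>

lemma unitary_equivalence_eq_iff:
  assumes U: "unitary_mat n U" and V: "unitary_mat n V"
    and U': "unitary_mat n U'" and V': "unitary_mat n V'"
    and D: "D \<in> carrier_mat n n" and D': "D' \<in> carrier_mat n n"
  shows "U * D * mat_adjoint V = U' * D' * mat_adjoint V' \<longleftrightarrow>
    (mat_adjoint U' * U) * D = D' * (mat_adjoint V' * V)" (is "?l \<longleftrightarrow> ?r")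
proof -
  note c = unitary_matD(1,2)[OF U] unitary_matD(1,2)[OF V] unitary_matD(1,2)[OF U']
    unitary_matD(1,2)[OF V'] D D'
  have canc: "mat_adjoint Q * (Q * X) = X" "Q * (mat_adjoint Q * X) = X"
    if "unitary_mat n Q" "X \<in> carrier_mat n n" for Q X
    using unitary_matD[OF that(1)] that(2) by (simp_all flip: assoc_mult_mat[of _ n n _ n _ n])
  note [simp] = assoc_mult_mat[of _ n n _ n _ n] mult_carrier_mat[of _ n n _ n]
    canc[OF U] canc[OF V] canc[OF U'] canc[OF V'] unitary_matD(3,4)[OF U] unitary_matD(3,4)[OF V]
    unitary_matD(3,4)[OF U'] unitary_matD(3,4)[OF V']
  show ?thesis
  proof
    assume ?l
    hence "mat_adjoint U' * (U * D * mat_adjoint V) * V = mat_adjoint U' * (U' * D' * mat_adjoint V') * V" by simp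
    thus ?r using c by simp
  next
    assume ?r
    hence "U' * ((mat_adjoint U' * U) * D) * mat_adjoint V = U' * (D' * (mat_adjoint V' * V)) * mat_adjoint V" by simp
    thus ?l using c by simp
  qed
qed

text \<open>A relation and not a function, since a matrix has many decompositions; it is the matrix
  counterpart of \<open>gtf_value\<close>.\<close>

definition svd_value :: "(real \<Rightarrow> real) \<Rightarrow> nat \<Rightarrow> complex mat \<Rightarrow> complex mat \<Rightarrow> bool" where
  "svd_value f n M Y \<longleftrightarrow> (\<exists>U D V. is_svd n M U D V \<and>
     Y = U * map_mat complex_of_real (ftilde f D) * mat_adjoint V)"

lemma svd_value_exists: "M \<in> carrier_mat n n \<Longrightarrow> \<exists>Y. svd_value f n M Y"
  using svd_exists[of M n] by (auto simp: svd_value_def)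

lemma svd_value_carrier: "svd_value f n M Y \<Longrightarrow> Y \<in> carrier_mat n n"
  by (auto simp: svd_value_def is_svd_def unitary_mat_def)

lemma ftilde_carrier[simp]: "D \<in> carrier_mat m n \<Longrightarrow> ftilde f D \<in> carrier_mat m n"
  by (simp add: ftilde_def)

lemma ftilde_diagonal: "diagonal_mat D \<Longrightarrow> diagonal_mat (ftilde f D)"
  by (auto simp: ftilde_def diagonal_mat_def)

text \<open>
  With \<open>W = U'\<^sup>H U\<close> and \<open>Z = V'\<^sup>H V\<close>, the two decompositions say \<open>w\<^sub>i\<^sub>j d\<^sub>j = d'\<^sub>i z\<^sub>i\<^sub>j\<close> and
  \<open>z\<^sub>i\<^sub>j d\<^sub>j = d'\<^sub>i w\<^sub>i\<^sub>j\<close>. Nonnegativity then forces \<open>w\<^sub>i\<^sub>j = 0\<close> or \<open>d\<^sub>j = d'\<^sub>i\<close>, which makes the same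
  relation hold after applying \<open>f\<close>.
\<close>
lemma svd_value_unique:
  assumes "svd_value f n M Y" "svd_value f n M Y'"
  shows "Y = Y'"
proof -
  obtain U D V U' D' V' where s: "is_svd n M U D V" "is_svd n M U' D' V'"
    and Y: "Y = U * map_mat complex_of_real (ftilde f D) * mat_adjoint V"
      "Y' = U' * map_mat complex_of_real (ftilde f D') * mat_adjoint V'"
    using assms by (auto simp: svd_value_def)
  have uni: "unitary_mat n U" "unitary_mat n V" "unitary_mat n U'" "unitary_mat n V'"
    and D: "D \<in> carrier_mat n n" "diagonal_mat D" "D' \<in> carrier_mat n n" "diagonal_mat D'"
    and nn: "\<And>i. i < n \<Longrightarrow> 0 \<le> D $$ (i, i)" "\<And>i. i < n \<Longrightarrow> 0 \<le> D' $$ (i, i)"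
    using s by (auto simp: is_svd_def nonneg_diag_def)
  note u = unitary_matD[OF uni(1)] and v = unitary_matD[OF uni(2)]
  note u' = unitary_matD[OF uni(3)] and v' = unitary_matD[OF uni(4)]
  let ?c = "map_mat complex_of_real"
  define W where "W = mat_adjoint U' * U"
  define Z where "Z = mat_adjoint V' * V"
  have WZ: "W \<in> carrier_mat n n" "Z \<in> carrier_mat n n"
    using u u' v v' by (auto simp: W_def Z_def)
  have dg: "diagonal_mat (?c E)" if "diagonal_mat E" for E
    using that by (auto simp: diagonal_mat_def)
  have tr: "transpose_mat E = E" if "diagonal_mat E" "E \<in> carrier_mat n n" for E :: "real mat"
    using that by (intro eq_matI) (auto simp: diagonal_mat_def, metis)
  have adj: "mat_adjoint (P * ?c E * mat_adjoint Q) = Q * ?c E * mat_adjoint P"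
    if "P \<in> carrier_mat n n" "Q \<in> carrier_mat n n" "E \<in> carrier_mat n n" "diagonal_mat E" for P Q E
    using that by (simp add: mat_adjoint_mult[of _ n n _ n] mult_carrier_mat[of _ n n _ n]
        mat_adjoint_of_real tr assoc_mult_mat[of _ n n _ n _ n])
  have eq: "U * ?c D * mat_adjoint V = U' * ?c D' * mat_adjoint V'"
    using s by (simp add: is_svd_def)
  have 1: "W * ?c D = ?c D' * Z"
    using unitary_equivalence_eq_iff[OF uni, of "?c D" "?c D'"] eq D by (simp add: W_def Z_def)
  \<comment> \<open>Real diagonal matrices are self-adjoint, so the adjoint of the equation
    exchanges the roles of the left and right factors and yields the second relation.\<close>
  have "V * ?c D * mat_adjoint U = V' * ?c D' * mat_adjoint U'"
    using arg_cong[OF eq, of mat_adjoint]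
    unfolding adj[OF u(1) v(1) D(1,2)] adj[OF u'(1) v'(1) D(3,4)] .
  hence 2: "Z * ?c D = ?c D' * W"
    using unitary_equivalence_eq_iff[OF uni(2,1,4,3), of "?c D" "?c D'"] D by (simp add: W_def Z_def)
  have "W * ?c (ftilde f D) = ?c (ftilde f D') * Z"
  proof (rule eq_matI)
    fix i j assume "i < dim_row (?c (ftilde f D') * Z)" "j < dim_col (?c (ftilde f D') * Z)"
    hence ij: "i < n" "j < n" using WZ D by (auto simp: ftilde_def)
    define s t where "s = D $$ (j, j)" and "t = D' $$ (i, i)"
    have st: "0 \<le> s" "0 \<le> t" using nn ij by (auto simp: s_def t_def)
    have e1: "W $$ (i, j) * of_real s = of_real t * Z $$ (i, j)"
      using arg_cong[OF 1, of "\<lambda>M. M $$ (i, j)"] ij D WZ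
      by (simp add: mult_right_diagonal_index[of _ n n] mult_left_diagonal_index[of _ n n] dg s_def t_def del: index_mult_mat)
    have e2: "Z $$ (i, j) * of_real s = of_real t * W $$ (i, j)"
      using arg_cong[OF 2, of "\<lambda>M. M $$ (i, j)"] ij D WZ
      by (simp add: mult_right_diagonal_index[of _ n n] mult_left_diagonal_index[of _ n n] dg s_def t_def del: index_mult_mat)
    have "W $$ (i, j) * of_real (if s > 0 then f s else 0) = of_real (if t > 0 then f t else 0) * Z $$ (i, j)"
    proof (cases "W $$ (i, j) = 0")
      case True
      thus ?thesis using e1 by auto
    next
      case False
      \<comment> \<open>Applying the two relations in turn removes \<open>Z\<close>; a nonzero entry
        of \<open>W\<close> then forces equal squares.\<close>
      have "W $$ (i, j) * of_real (s\<^sup>2) = (W $$ (i, j) * of_real s) * of_real s"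
        by (simp add: power2_eq_square)
      also have "\<dots> = of_real t * (Z $$ (i, j) * of_real s)" by (simp add: e1)
      also have "\<dots> = W $$ (i, j) * of_real (t\<^sup>2)" by (simp add: e2 power2_eq_square)
      finally have "W $$ (i, j) * of_real (s\<^sup>2) = W $$ (i, j) * of_real (t\<^sup>2)" .
      hence "s\<^sup>2 = t\<^sup>2" using False by (simp del: of_real_power)
      hence t: "t = s" using st by simp
      \<comment> \<open>For \<open>s = 0\<close> both sides of the claim vanish, as
        \<open>ftilde\<close> leaves 0 in place of a zero singular value. Otherwise \<open>s\<close>
        cancels.\<close>
      have "W $$ (i, j) = Z $$ (i, j)" if "s \<noteq> 0"
        using e1 that unfolding t by (metis mult.commute mult_cancel_left of_real_eq_0_iff)
      thus ?thesis unfolding t by simp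
    qed
    moreover have "ftilde f D $$ (j, j) = (if s > 0 then f s else 0)"
      "ftilde f D' $$ (i, i) = (if t > 0 then f t else 0)"
      using ij D by (simp_all add: ftilde_def s_def t_def)
    moreover have "(W * ?c (ftilde f D)) $$ (i, j) = W $$ (i, j) * ?c (ftilde f D) $$ (j, j)"
      using ij D WZ by (intro mult_right_diagonal_index[of _ n n]) (auto intro!: dg ftilde_diagonal)
    moreover have "(?c (ftilde f D') * Z) $$ (i, j) = ?c (ftilde f D') $$ (i, i) * Z $$ (i, j)"
      using ij D WZ by (intro mult_left_diagonal_index[of _ n n]) (auto intro!: dg ftilde_diagonal)
    ultimately show "(W * ?c (ftilde f D)) $$ (i, j) = (?c (ftilde f D') * Z) $$ (i, j)"
      using ij carrier_matD[OF ftilde_carrier[OF D(1), of f]] carrier_matD[OF ftilde_carrier[OF D(3), of f]]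
      by (simp del: index_mult_mat)
  qed (use WZ D in \<open>auto simp: ftilde_def\<close>)
  thus ?thesis
    using unitary_equivalence_eq_iff[OF uni, of "?c (ftilde f D)" "?c (ftilde f D')"] D
    by (simp add: W_def Z_def Y)
qed

text \<open>Only the unitary factors change, to \<open>W * U\<close> and \<open>Z * V\<close>; the
  singular values seen by \<open>f\<close> stay the same.\<close>

lemma svd_value_conj:
  assumes M: "svd_value f n M Y" and W: "unitary_mat n W" and Z: "unitary_mat n Z"
  shows "svd_value f n (W * M * mat_adjoint Z) (W * Y * mat_adjoint Z)"
proof -
  obtain U D V where s: "is_svd n M U D V" and Y: "Y = U * map_mat complex_of_real (ftilde f D) * mat_adjoint V"
    using M by (auto simp: svd_value_def)
  have c: "U \<in> carrier_mat n n" "V \<in> carrier_mat n n" "map_mat complex_of_real (ftilde f D) \<in> carrier_mat n n"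
     "W \<in> carrier_mat n n" "Z \<in> carrier_mat n n"
    using s W Z by (auto simp: is_svd_def unitary_mat_def nonneg_diag_def)
  have "W * Y * mat_adjoint Z = (W * U) * map_mat complex_of_real (ftilde f D) * mat_adjoint (Z * V)"
    unfolding Y using c
    by (simp add: mat_adjoint_mult[of _ n n _ n] assoc_mult_mat[of _ n n _ n _ n] mult_carrier_mat[of _ n n _ n])
  thus ?thesis using is_svd_conj[OF s W Z] by (auto simp: svd_value_def)
qed

text \<open>\<open>ftilde\<close> acts entrywise and fixes 0, so it keeps the zero blocks and acts
  on the two diagonal blocks separately.\<close>

lemma svd_value_four_block_diag:
  assumes M: "svd_value f m M Y" and N: "svd_value f n N Y'"
  shows "svd_value f (m + n) (four_block_mat M (0\<^sub>m m n) (0\<^sub>m n m) N)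
    (four_block_mat Y (0\<^sub>m m n) (0\<^sub>m n m) Y')"
proof -
  let ?c = "map_mat complex_of_real"
  obtain U D V U' D' V' where s: "is_svd m M U D V" "is_svd n N U' D' V'"
    and Y: "Y = U * ?c (ftilde f D) * mat_adjoint V" "Y' = U' * ?c (ftilde f D') * mat_adjoint V'"
    using assms by (auto simp: svd_value_def)
  have c: "U \<in> carrier_mat m m" "V \<in> carrier_mat m m" "D \<in> carrier_mat m m"
    "U' \<in> carrier_mat n n" "V' \<in> carrier_mat n n" "D' \<in> carrier_mat n n"
    using s by (auto simp: is_svd_def unitary_mat_def nonneg_diag_def)
  have "?c (ftilde f (four_block_mat D (0\<^sub>m m n) (0\<^sub>m n m) D')) =
      four_block_mat (?c (ftilde f D)) (0\<^sub>m m n) (0\<^sub>m n m) (?c (ftilde f D'))"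
    using c by (intro eq_matI) (auto simp: ftilde_def)
  hence "four_block_mat Y (0\<^sub>m m n) (0\<^sub>m n m) Y' = four_block_mat U (0\<^sub>m m n) (0\<^sub>m n m) U'
      * ?c (ftilde f (four_block_mat D (0\<^sub>m m n) (0\<^sub>m n m) D'))
      * mat_adjoint (four_block_mat V (0\<^sub>m m n) (0\<^sub>m n m) V')"
    using c by (simp add: Y mat_adjoint_four_block[of _ m m _ n _ n]
        mult_four_block_diag[of _ m m _ n n _ m _ n])
  thus ?thesis unfolding svd_value_def using is_svd_four_block_diag[OF s] by blast
qed

lemma map_mat_cnj_mult:
  assumes "A \<in> carrier_mat m n" "B \<in> carrier_mat n l"
  shows "map_mat cnj (A * B) = map_mat cnj A * map_mat cnj B"
  using assms by (intro eq_matI) (auto simp: scalar_prod_def)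

lemma mat_adjoint_map_cnj: "mat_adjoint (map_mat cnj A) = map_mat cnj (mat_adjoint A)"
  by (rule eq_matI) auto

lemma unitary_mat_cnj:
  assumes "unitary_mat n U"
  shows "unitary_mat n (map_mat cnj U)"
proof -
  note u = unitary_matD[OF assms]
  have "mat_adjoint (map_mat cnj U) * map_mat cnj U = map_mat cnj (mat_adjoint U * U)"
    unfolding mat_adjoint_map_cnj map_mat_cnj_mult[OF u(2,1)] ..
  also have "\<dots> = 1\<^sub>m n" unfolding u(3) by (rule eq_matI) auto
  finally show ?thesis using u by (simp add: unitary_mat_def)
qed

text \<open>The diagonal factors are real, so conjugation reaches only the unitary factors.\<close>

lemma svd_value_cnj:
  assumes "svd_value f n M Y"
  shows "svd_value f n (map_mat cnj M) (map_mat cnj Y)"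
proof -
  let ?c = "map_mat complex_of_real"
  obtain U D V where s: "is_svd n M U D V" and Y: "Y = U * ?c (ftilde f D) * mat_adjoint V"
    using assms by (auto simp: svd_value_def)
  have c: "U \<in> carrier_mat n n" "V \<in> carrier_mat n n" "D \<in> carrier_mat n n"
    using s by (auto simp: is_svd_def unitary_mat_def nonneg_diag_def)
  have r: "map_mat cnj (?c E) = ?c E" for E by (rule eq_matI) auto
  have *: "map_mat cnj (U * ?c E * mat_adjoint V) = map_mat cnj U * ?c E * mat_adjoint (map_mat cnj V)"
    if "E \<in> carrier_mat n n" for E
    using c that by (simp add: map_mat_cnj_mult[of _ n n _ n] r mat_adjoint_map_cnj mult_carrier_mat[of _ n n _ n])
  have "is_svd n (map_mat cnj M) (map_mat cnj U) D (map_mat cnj V)"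
    using s c by (auto simp: is_svd_def unitary_mat_cnj *)
  thus ?thesis unfolding svd_value_def Y using * c by (metis ftilde_carrier)
qed

section \<open>Fourier transform along the slices\<close>

definition root_of_unity :: "nat \<Rightarrow> complex" where
  "root_of_unity p = cis (- 2 * pi / real p)"

lemma root_of_unity_pow: "0 < p \<Longrightarrow> root_of_unity p ^ p = 1"
  by (simp add: root_of_unity_def DeMoivre complex_eq_iff)

lemma root_of_unity_cnj: "root_of_unity p ^ k * cnj (root_of_unity p) ^ k = 1"
  by (simp add: root_of_unity_def cis_cnj cis_mult flip: power_mult_distrib)

lemma root_of_unity_mod:
  assumes "0 < p"
  shows "root_of_unity p ^ (a mod p * k) = root_of_unity p ^ (a * k)"
proof -
  have "root_of_unity p ^ a = root_of_unity p ^ (p * (a div p) + a mod p)" by simp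
  also have "\<dots> = root_of_unity p ^ (a mod p)"
    unfolding power_add power_mult root_of_unity_pow[OF assms] by simp
  finally show ?thesis by (simp add: power_mult)
qed

text \<open>The conjugate power is the inverse power, so this splits the root with exponent
  \<open>(a - b) * k\<close>. The left side has the form in which \<open>bcirc\<close> indexes its
  blocks.\<close>

lemma root_of_unity_diff:
  assumes "b < p"
  shows "root_of_unity p ^ ((a + p - b) mod p * k) = root_of_unity p ^ (a * k) * cnj (root_of_unity p) ^ (b * k)"
proof -
  let ?w = "root_of_unity p"
  have "?w ^ ((a + p - b) * k) * ?w ^ (b * k) = ?w ^ (a * k) * ?w ^ (p * k)"
    using assms by (simp flip: power_add distrib_right)
  hence "?w ^ ((a + p - b) * k) * ?w ^ (b * k) = ?w ^ (a * k)"
    using root_of_unity_pow[of p] assms by (simp add: power_mult)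
  hence "?w ^ ((a + p - b) * k) * (?w ^ (b * k) * cnj ?w ^ (b * k)) = ?w ^ (a * k) * cnj ?w ^ (b * k)"
    by (metis mult.assoc)
  thus ?thesis using assms by (simp add: root_of_unity_mod root_of_unity_cnj)
qed

lemma root_of_unity_inj:
  assumes "j < p" "l < p" "root_of_unity p ^ j = root_of_unity p ^ l"
  shows "j = l"
proof -
  \<comment> \<open>Conjugation changes the sign of the exponent to the one in
    \<open>bij_betw_roots_unity\<close>.\<close>
  have "cnj (root_of_unity p ^ j) = cnj (root_of_unity p ^ l)" using assms by simp
  hence "cis (2 * pi * real j / real p) = cis (2 * pi * real l / real p)"
    by (simp add: root_of_unity_def cis_cnj DeMoivre mult_ac)
  thus ?thesis
    using bij_betw_roots_unity[of p] assms(1,2) by (auto simp: bij_betw_def inj_on_def)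
qed

text \<open>The terms are the powers of a \<open>p\<close>-th root of unity, which is 1 exactly when
  \<open>j = l\<close>; otherwise the geometric sum vanishes.\<close>

lemma root_of_unity_orthogonal:
  assumes "j < p" "l < p"
  shows "(\<Sum>k<p. root_of_unity p ^ (j * k) * cnj (root_of_unity p) ^ (l * k)) = (if j = l then of_nat p else 0)"
proof -
  define z where "z = root_of_unity p ^ j * cnj (root_of_unity p) ^ l"
  have zk: "root_of_unity p ^ (j * k) * cnj (root_of_unity p) ^ (l * k) = z ^ k" for k
    by (simp add: z_def power_mult power_mult_distrib)
  show ?thesis
  proof (cases "j = l")
    case True
    hence "z = 1" by (simp add: z_def root_of_unity_cnj)
    thus ?thesis unfolding zk using True by simp
  next
    case False
    have zp: "z ^ p = 1"
      using root_of_unity_pow[of p] assms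
      by (simp add: z_def power_mult_distrib flip: power_mult complex_cnj_power)
        (simp add: mult.commute[of _ p] power_mult)
    have "z \<noteq> 1"
    proof
      assume "z = 1"
      hence "root_of_unity p ^ j * (cnj (root_of_unity p) ^ l * root_of_unity p ^ l) = root_of_unity p ^ l"
        by (simp add: z_def flip: mult.assoc)
      hence "root_of_unity p ^ j = root_of_unity p ^ l"
        by (simp add: root_of_unity_cnj mult.commute)
      thus False using root_of_unity_inj assms False by blast
    qed
    hence "(\<Sum>k<p. z ^ k) = 0" using zp by (simp add: sum_gp_strict)
    thus ?thesis using False by (simp add: zk)
  qed
qed

text \<open>The conjugate root gives the sign opposite to \<open>fourier_mat\<close>. With this sign
  the blocks in \<open>fourier_block_diag\<close> are the transforms of the block circulant tensor.
  The whole factor \<open>1 / p\<close> goes to the inverse \<open>tidft\<close>, which makes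
  \<open>tdft\<close> multiplicative without a scalar.\<close>

definition tdft :: "nat \<Rightarrow> nat \<Rightarrow> complex tensor \<Rightarrow> nat \<Rightarrow> complex mat" where
  "tdft m n A j = mat m n (\<lambda>(r, c). \<Sum>k<length A. cnj (root_of_unity (length A)) ^ (j * k) * A ! k $$ (r, c))"

definition tidft :: "nat \<Rightarrow> nat \<Rightarrow> nat \<Rightarrow> (nat \<Rightarrow> complex mat) \<Rightarrow> complex tensor" where
  "tidft m n p G = map (\<lambda>k. mat m n (\<lambda>(r, c).
     (\<Sum>j<p. root_of_unity p ^ (j * k) * G j $$ (r, c)) / of_nat p)) [0..<p]"

lemma tdft_carrier[simp]: "tdft m n A j \<in> carrier_mat m n"
  by (simp add: tdft_def)

lemma tdft_dim[simp]: "dim_row (tdft m n A j) = m" "dim_col (tdft m n A j) = n"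
  by (simp_all add: tdft_def)

lemma tidft_carrier[simp]: "tidft m n p G \<in> carrier_tensor m n p"
  by (auto simp: tidft_def carrier_tensor_def)

lemma carrier_tensorD:
  assumes "A \<in> carrier_tensor m n p"
  shows "length A = p" "k < p \<Longrightarrow> A ! k \<in> carrier_mat m n"
  using assms by (auto simp: carrier_tensor_def)

lemma carrier_tensor_eqI:
  assumes A: "A \<in> carrier_tensor m n p" and B: "B \<in> carrier_tensor m n p"
    and eq: "\<And>k i j. k < p \<Longrightarrow> i < m \<Longrightarrow> j < n \<Longrightarrow> A ! k $$ (i, j) = B ! k $$ (i, j)"
  shows "A = B"
proof (rule nth_equalityI)
  show "length A = length B" using carrier_tensorD(1)[OF A] carrier_tensorD(1)[OF B] by simp
  fix k assume "k < length A"
  hence k: "k < p" using carrier_tensorD(1)[OF A] by simp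
  show "A ! k = B ! k"
    using carrier_tensorD(2)[OF A k] carrier_tensorD(2)[OF B k] eq[OF k] by (intro eq_matI) auto
qed

lemma tdft_tidft:
  assumes G: "G j \<in> carrier_mat m n" and j: "j < p"
  shows "tdft m n (tidft m n p G) j = G j"
proof (rule eq_matI)
  fix r c assume "r < dim_row (G j)" "c < dim_col (G j)"
  hence rc: "r < m" "c < n" using G by auto
  let ?w = "root_of_unity p"
  have "tdft m n (tidft m n p G) j $$ (r, c) =
      (\<Sum>k<p. cnj ?w ^ (j * k) * ((\<Sum>l<p. ?w ^ (l * k) * G l $$ (r, c)) / of_nat p))"
    using rc by (simp add: tdft_def tidft_def)
  also have "\<dots> = (\<Sum>k<p. \<Sum>l<p. ?w ^ (l * k) * cnj ?w ^ (j * k) * (G l $$ (r, c) / of_nat p))"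
    by (simp add: sum_distrib_left sum_divide_distrib mult_ac)
  also have "\<dots> = (\<Sum>l<p. (\<Sum>k<p. ?w ^ (l * k) * cnj ?w ^ (j * k)) * (G l $$ (r, c) / of_nat p))"
    by (subst sum.swap) (simp only: sum_distrib_right)
  also have "\<dots> = (\<Sum>l<p. if l = j then G j $$ (r, c) else 0)"
    using j by (intro sum.cong) (auto simp: root_of_unity_orthogonal)
  also have "\<dots> = G j $$ (r, c)" using j by simp
  finally show "tdft m n (tidft m n p G) j $$ (r, c) = G j $$ (r, c)" .
qed (use G in auto)

lemma tidft_tdft:
  assumes A: "A \<in> carrier_tensor m n p"
  shows "tidft m n p (tdft m n A) = A"
proof (rule carrier_tensor_eqI[OF tidft_carrier A])
  fix k r c assume k: "k < p" and rc: "r < m" "c < n"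
  let ?w = "root_of_unity p"
  have "tidft m n p (tdft m n A) ! k $$ (r, c) =
      (\<Sum>j<p. ?w ^ (j * k) * (\<Sum>l<p. cnj ?w ^ (j * l) * A ! l $$ (r, c))) / of_nat p"
    using rc k carrier_tensorD(1)[OF A] by (simp add: tdft_def tidft_def)
  also have "\<dots> = (\<Sum>j<p. \<Sum>l<p. ?w ^ (k * j) * cnj ?w ^ (l * j) * (A ! l $$ (r, c) / of_nat p))"
    by (simp add: sum_distrib_left sum_divide_distrib mult_ac)
  also have "\<dots> = (\<Sum>l<p. (\<Sum>j<p. ?w ^ (k * j) * cnj ?w ^ (l * j)) * (A ! l $$ (r, c) / of_nat p))"
    by (subst sum.swap) (simp only: sum_distrib_right)
  also have "\<dots> = (\<Sum>l<p. if l = k then A ! k $$ (r, c) else 0)"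
    using k by (intro sum.cong) (auto simp: root_of_unity_orthogonal)
  also have "\<dots> = A ! k $$ (r, c)" using k by simp
  finally show "tidft m n p (tdft m n A) ! k $$ (r, c) = A ! k $$ (r, c)" .
qed

lemma tdft_eqI:
  assumes A: "A \<in> carrier_tensor m n p" and B: "B \<in> carrier_tensor m n p"
    and eq: "\<And>j. j < p \<Longrightarrow> tdft m n A j = tdft m n B j"
  shows "A = B"
proof -
  have "tidft m n p (tdft m n A) = tidft m n p (tdft m n B)"
    using eq by (simp add: tidft_def)
  thus ?thesis by (simp add: tidft_tdft[OF A] tidft_tdft[OF B])
qed

section \<open>T-product, T-adjoint and identity tensor under the transform\<close>

lemma sum_blocks:
  fixes g :: "nat \<Rightarrow> 'a :: comm_monoid_add"
  shows "(\<Sum>x<n * p. g x) = (\<Sum>l<p. \<Sum>t<n. g (l * n + t))"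
proof (induction p)
  case (Suc p)
  have split: "(\<Sum>x<a + b. g x) = (\<Sum>x<a. g x) + (\<Sum>t<b. g (a + t))" for a b
    by (induction b) (simp_all add: add.assoc)
  have "(\<Sum>x<n * Suc p. g x) = (\<Sum>x<n * p + n. g x)" by (simp add: add.commute)
  also have "\<dots> = (\<Sum>x<n * p. g x) + (\<Sum>t<n. g (n * p + t))"
    by (rule split)
  finally show ?case using Suc by (simp add: mult.commute)
qed simp

lemma block_index_less:
  fixes k i m p :: nat
  assumes "k < p" "i < m"
  shows "k * m + i < m * p"
proof -
  have "k * m + i < Suc k * m" using assms by simp
  also have "\<dots> \<le> p * m" using assms by (intro mult_le_mono1) simp
  finally show ?thesis by (simp add: mult.commute)
qed

lemma block_index_cases:
  fixes x m p :: nat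
  assumes "x < m * p"
  obtains k i where "k < p" "i < m" "x = k * m + i"
proof
  have m: "0 < m" using assms by (cases m) auto
  show "x div m < p" using assms by (simp add: less_mult_imp_div_less mult.commute)
  show "x mod m < m" using m by simp
qed simp

lemma tprod_carrier:
  assumes "A \<in> carrier_tensor m n p" "B \<in> carrier_tensor n s p" "0 < p"
  shows "A \<star> B \<in> carrier_tensor m s p"
  using assms carrier_tensorD(1)[OF assms(1)] carrier_tensorD(1)[OF assms(2)]
    tnrows_carrier[OF assms(1,3)] tncols_carrier[OF assms(2,3)]
  by (auto simp: tprod_def fold_tensor_def bcirc_def unfold_tensor_def Let_def carrier_tensor_def)

lemma bcirc_index:
  assumes A: "A \<in> carrier_tensor m n p" and "a < p" "b < p" "r < m" "c < n"
  shows "bcirc A $$ (a * m + r, b * n + c) = A ! ((a + p - b) mod p) $$ (r, c)"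
  using assms carrier_tensorD(1)[OF A] tnrows_carrier[OF A] tncols_carrier[OF A]
    block_index_less[of a p r m] block_index_less[of b p c n]
  by (simp add: bcirc_def Let_def)

lemma bcirc_dim:
  assumes A: "A \<in> carrier_tensor m n p" and "0 < p"
  shows "dim_row (bcirc A) = m * p" "dim_col (bcirc A) = n * p"
  using assms carrier_tensorD(1)[OF A] tnrows_carrier[OF A] tncols_carrier[OF A]
  by (simp_all add: bcirc_def Let_def)

text \<open>The T-product is the circular convolution of the slices, with matrix products in place
  of scalar ones.\<close>

lemma tprod_index:
  assumes A: "A \<in> carrier_tensor m n p" and B: "B \<in> carrier_tensor n s p"
    and k: "k < p" and i: "i < m" and c: "c < s"
  shows "(A \<star> B) ! k $$ (i, c) = (\<Sum>l<p. \<Sum>t<n. A ! ((k + p - l) mod p) $$ (i, t) * B ! l $$ (t, c))"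
proof -
  have p: "0 < p" using k by simp
  note sz = carrier_tensorD(1)[OF A] carrier_tensorD(1)[OF B] bcirc_dim[OF A p]
    tnrows_carrier[OF B p] tncols_carrier[OF B p]
  have ki: "k * m + i < m * p" using block_index_less[OF k i] .
  have "(A \<star> B) ! k $$ (i, c) = (bcirc A * unfold_tensor B) $$ (k * m + i, c)"
    using k i c sz by (simp add: tprod_def fold_tensor_def Let_def unfold_tensor_def del: index_mult_mat(1))
  also have "\<dots> = (\<Sum>x<n * p. bcirc A $$ (k * m + i, x) * unfold_tensor B $$ (x, c))"
    using ki c sz by (simp add: unfold_tensor_def Let_def scalar_prod_def atLeast0LessThan)
  also have "\<dots> = (\<Sum>l<p. \<Sum>t<n. bcirc A $$ (k * m + i, l * n + t) * unfold_tensor B $$ (l * n + t, c))"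
    by (rule sum_blocks)
  also have "\<dots> = (\<Sum>l<p. \<Sum>t<n. A ! ((k + p - l) mod p) $$ (i, t) * B ! l $$ (t, c))"
    using k i c sz block_index_less
    by (intro sum.cong refl) (auto simp: bcirc_index[OF A] unfold_tensor_def Let_def)
  finally show ?thesis .
qed

lemma sum_cyclic_shift:
  fixes h :: "nat \<Rightarrow> nat \<Rightarrow> 'a :: comm_monoid_add"
  assumes l: "l < p"
  shows "(\<Sum>k<p. h k ((k + p - l) mod p)) = (\<Sum>k<p. h ((k + l) mod p) k)"
proof (rule sum.reindex_bij_witness[of _ "\<lambda>k. (k + l) mod p" "\<lambda>k. (k + p - l) mod p"])
  fix k assume k: "k \<in> {..<p}"
  show 1: "((k + p - l) mod p + l) mod p = k" using k l by (simp add: mod_add_left_eq)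
  show "((k + l) mod p + p - l) mod p = k"
  proof -
    have "(k + l) mod p + p - l = (k + l) mod p + (p - l)" using l by simp
    hence "((k + l) mod p + p - l) mod p = (k + l + (p - l)) mod p" by (metis mod_add_left_eq)
    thus ?thesis using k l by simp
  qed
  show "h (((k + p - l) mod p + l) mod p) ((k + p - l) mod p) = h k ((k + p - l) mod p)" using 1 by simp
qed (use l in auto)

text \<open>The convolution theorem: for fixed \<open>l\<close> the summation index is shifted
  cyclically by \<open>l\<close>, and the power of the root, which depends on the exponent only
  modulo \<open>p\<close>, splits into a factor for each tensor.\<close>

lemma tdft_tprod:
  assumes A: "A \<in> carrier_tensor m n p" and B: "B \<in> carrier_tensor n s p" and p: "0 < p"
  shows "tdft m s (A \<star> B) j = tdft m n A j * tdft n s B j"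
proof (rule eq_matI)
  fix r c assume "r < dim_row (tdft m n A j * tdft n s B j)" "c < dim_col (tdft m n A j * tdft n s B j)"
  hence rc: "r < m" "c < s" by auto
  let ?z = "cnj (root_of_unity p)"
  note len = carrier_tensorD(1)[OF A] carrier_tensorD(1)[OF B] carrier_tensorD(1)[OF tprod_carrier[OF A B p]]
  have zmod: "?z ^ (j * ((k + l) mod p)) = ?z ^ (j * k) * ?z ^ (j * l)" for k l
    using arg_cong[OF root_of_unity_mod[OF p, of "k + l" j], of cnj]
    by (simp add: mult.commute[of j] add_mult_distrib power_add)
  have "tdft m s (A \<star> B) j $$ (r, c) =
      (\<Sum>k<p. ?z ^ (j * k) * (\<Sum>l<p. \<Sum>t<n. A ! ((k + p - l) mod p) $$ (r, t) * B ! l $$ (t, c)))"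
    using rc len by (simp add: tdft_def tprod_index[OF A B])
  also have "\<dots> = (\<Sum>l<p. \<Sum>k<p. ?z ^ (j * k) * (\<Sum>t<n. A ! ((k + p - l) mod p) $$ (r, t) * B ! l $$ (t, c)))"
    unfolding sum_distrib_left[of _ _ "{..<p}"] by (rule sum.swap)
  also have "\<dots> = (\<Sum>l<p. \<Sum>k<p. ?z ^ (j * ((k + l) mod p)) * (\<Sum>t<n. A ! k $$ (r, t) * B ! l $$ (t, c)))"
  proof (rule sum.cong[OF refl])
    fix l assume "l \<in> {..<p}"
    thus "(\<Sum>k<p. ?z ^ (j * k) * (\<Sum>t<n. A ! ((k + p - l) mod p) $$ (r, t) * B ! l $$ (t, c))) =
        (\<Sum>k<p. ?z ^ (j * ((k + l) mod p)) * (\<Sum>t<n. A ! k $$ (r, t) * B ! l $$ (t, c)))"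
      using sum_cyclic_shift[of l p "\<lambda>k k'. ?z ^ (j * k) * (\<Sum>t<n. A ! k' $$ (r, t) * B ! l $$ (t, c))"]
      by simp
  qed
  also have "\<dots> = (\<Sum>l<p. \<Sum>k<p. \<Sum>t<n. (?z ^ (j * k) * A ! k $$ (r, t)) * (?z ^ (j * l) * B ! l $$ (t, c)))"
    by (simp add: zmod sum_distrib_left mult_ac)
  also have "\<dots> = (\<Sum>l<p. \<Sum>t<n. \<Sum>k<p. (?z ^ (j * k) * A ! k $$ (r, t)) * (?z ^ (j * l) * B ! l $$ (t, c)))"
    by (intro sum.cong refl sum.swap)
  also have "\<dots> = (\<Sum>t<n. \<Sum>l<p. \<Sum>k<p. (?z ^ (j * k) * A ! k $$ (r, t)) * (?z ^ (j * l) * B ! l $$ (t, c)))"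
    by (rule sum.swap)
  also have "\<dots> = (\<Sum>t<n. (\<Sum>k<p. ?z ^ (j * k) * A ! k $$ (r, t)) * (\<Sum>l<p. ?z ^ (j * l) * B ! l $$ (t, c)))"
    by (simp only: sum_distrib_left sum_distrib_right)
  also have "\<dots> = (tdft m n A j * tdft n s B j) $$ (r, c)"
    using rc len by (simp add: tdft_def scalar_prod_def atLeast0LessThan)
  finally show "tdft m s (A \<star> B) j $$ (r, c) = (tdft m n A j * tdft n s B j) $$ (r, c)" .
qed auto

lemma tadjoint_carrier:
  assumes A: "A \<in> carrier_tensor m n p" and p: "0 < p"
  shows "tadjoint A \<in> carrier_tensor n m p"
  using carrier_tensorD[OF A] p by (auto simp: tadjoint_def carrier_tensor_def Let_def)

lemma sum_cyclic_reverse: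
  fixes h :: "nat \<Rightarrow> nat \<Rightarrow> 'a :: comm_monoid_add"
  shows "(\<Sum>k<p. h k ((p - k) mod p)) = (\<Sum>k<p. h ((p - k) mod p) k)"
proof -
  have inv: "(p - (p - k) mod p) mod p = k" if "k < p" for k
    using that by (cases "k = 0") auto
  show ?thesis
    by (rule sum.reindex_bij_witness[of _ "\<lambda>k. (p - k) mod p" "\<lambda>k. (p - k) mod p"]) (auto simp: inv)
qed

lemma root_of_unity_reverse:
  assumes "k \<le> p" "0 < p"
  shows "root_of_unity p ^ ((p - k) mod p * j) = cnj (root_of_unity p) ^ (k * j)"
proof -
  let ?w = "root_of_unity p"
  have "?w ^ ((p - k) * j) * ?w ^ (k * j) = ?w ^ (p * j)"
    using assms by (simp flip: power_add distrib_right)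
  also have "\<dots> = 1" using assms by (simp add: power_mult root_of_unity_pow)
  finally have "?w ^ ((p - k) * j) * ?w ^ (k * j) = 1" .
  hence "?w ^ ((p - k) * j) * (?w ^ (k * j) * cnj ?w ^ (k * j)) = cnj ?w ^ (k * j)"
    by (simp flip: mult.assoc)
  thus ?thesis using assms by (simp add: root_of_unity_mod root_of_unity_cnj)
qed

text \<open>Conjugating the slices alone would turn frequency \<open>j\<close> into
  \<open>-j\<close>; the reversed slice order in \<open>tadjoint\<close> undoes this, so the
  frequency is kept.\<close>

lemma tdft_tadjoint:
  assumes A: "A \<in> carrier_tensor m n p" and p: "0 < p"
  shows "tdft n m (tadjoint A) j = mat_adjoint (tdft m n A j)"
proof (rule eq_matI)
  fix r c assume "r < dim_row (mat_adjoint (tdft m n A j))" "c < dim_col (mat_adjoint (tdft m n A j))"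
  hence rc: "r < n" "c < m" by auto
  let ?z = "cnj (root_of_unity p)"
  note len = carrier_tensorD(1)[OF A] carrier_tensorD(1)[OF tadjoint_carrier[OF A p]]
  have dims: "dim_row (A ! (x mod p)) = m" "dim_col (A ! (x mod p)) = n" for x
    using carrier_tensorD(2)[OF A, of "x mod p"] p by auto
  have "tdft n m (tadjoint A) j $$ (r, c) = (\<Sum>k<p. ?z ^ (j * k) * cnj (A ! ((p - k) mod p) $$ (c, r)))"
    using rc len by (simp add: tdft_def) (simp add: tadjoint_def len Let_def dims)
  also have "\<dots> = (\<Sum>k<p. ?z ^ (j * ((p - k) mod p)) * cnj (A ! k $$ (c, r)))"
    by (rule sum_cyclic_reverse[where h = "\<lambda>k k'. ?z ^ (j * k) * cnj (A ! k' $$ (c, r))"])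
  also have "\<dots> = (\<Sum>k<p. cnj (?z ^ (j * k) * A ! k $$ (c, r)))"
    using arg_cong[OF root_of_unity_reverse[of _ p j], where f = cnj] p
    by (intro sum.cong) (auto simp: mult.commute[of j])
  finally show "tdft n m (tadjoint A) j $$ (r, c) = mat_adjoint (tdft m n A j) $$ (r, c)"
    using rc len by (simp add: tdft_def)
qed auto

lemma tid_carrier: "tid n p \<in> carrier_tensor n n p"
  by (auto simp: tid_def carrier_tensor_def)

lemma tdft_tid:
  assumes "0 < p"
  shows "tdft n n (tid n p) j = 1\<^sub>m n"
proof (rule eq_matI)
  fix r c assume rc: "r < dim_row (1\<^sub>m n :: complex mat)" "c < dim_col (1\<^sub>m n :: complex mat)"
  let ?z = "cnj (root_of_unity p)"
  have "tdft n n (tid n p) j $$ (r, c) =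
      (\<Sum>k<p. ?z ^ (j * k) * (if k = 0 then 1\<^sub>m n else 0\<^sub>m n n) $$ (r, c))"
    using rc by (simp add: tdft_def tid_def)
  also have "\<dots> = (\<Sum>k<p. if k = 0 then 1\<^sub>m n $$ (r, c) else 0)"
    by (rule sum.cong) (use rc in auto)
  finally show "tdft n n (tid n p) j $$ (r, c) = 1\<^sub>m n $$ (r, c)" using assms by simp
qed auto

text \<open>The identity tensor has the identity matrix at every frequency, and a tensor is
  determined by its transform.\<close>

lemma tunitary_iff:
  assumes p: "0 < p"
  shows "tunitary n p Q \<longleftrightarrow> Q \<in> carrier_tensor n n p \<and> (\<forall>j<p. unitary_mat n (tdft n n Q j))"
proof (intro iffI conjI allI impI)
  assume Q: "tunitary n p Q"
  thus c: "Q \<in> carrier_tensor n n p" by (simp add: tunitary_def)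
  fix j
  have "tdft n n (tadjoint Q \<star> Q) j = 1\<^sub>m n" using Q p by (simp add: tunitary_def tdft_tid)
  thus "unitary_mat n (tdft n n Q j)"
    using c p by (simp add: unitary_mat_def tdft_tprod[of _ n n p _ n] tdft_tadjoint tadjoint_carrier)
next
  assume Q: "Q \<in> carrier_tensor n n p \<and> (\<forall>j<p. unitary_mat n (tdft n n Q j))"
  note c = conjunct1[OF Q] tadjoint_carrier[OF conjunct1[OF Q] p]
  note u = unitary_matD(3,4)[of n "tdft n n Q _"]
  have "tadjoint Q \<star> Q = tid n p"
    by (rule tdft_eqI[OF tprod_carrier[OF c(2,1) p] tid_carrier])
      (use Q p u in \<open>simp add: tdft_tprod[OF c(2,1)] tdft_tadjoint[OF c(1)] tdft_tid\<close>)
  moreover have "Q \<star> tadjoint Q = tid n p"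
    by (rule tdft_eqI[OF tprod_carrier[OF c p] tid_carrier])
      (use Q p u in \<open>simp add: tdft_tprod[OF c] tdft_tadjoint[OF c(1)] tdft_tid\<close>)
  ultimately show "tunitary n p Q" using Q by (simp add: tunitary_def)
qed

section \<open>Diagonalization of block circulant matrices by the Fourier matrix\<close>

lemma diag_block_mat_index:
  assumes "\<forall>D\<in>set Ds. D \<in> carrier_mat m n" "k < length Ds" "l < length Ds" "r < m" "c < n"
  shows "diag_block_mat Ds $$ (k * m + r, l * n + c) = (if k = l then Ds ! k $$ (r, c) else 0)"
  using assms
proof (induction Ds arbitrary: k l)
  case (Cons D Ds)
  have D: "D \<in> carrier_mat m n" using Cons.prems by simp
  have "sum_list (map dim_row Ds) = m * length Ds" "sum_list (map dim_col Ds) = n * length Ds"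
    using Cons.prems(1) by (induction Ds) auto
  hence dim: "dim_row (diag_block_mat Ds) = m * length Ds" "dim_col (diag_block_mat Ds) = n * length Ds"
    by (simp_all add: dim_diag_block_mat)
  have lt: "k * m + r < m + m * length Ds" "l * n + c < n + n * length Ds"
    using block_index_less[of k "Suc (length Ds)" r m] block_index_less[of l "Suc (length Ds)" c n] Cons.prems by auto
  show ?case
    using Cons.IH[of "k - 1" "l - 1"] Cons.prems D lt dim
      block_index_less[of "k - 1" "length Ds" r m] block_index_less[of "l - 1" "length Ds" c n]
    by (cases k; cases l) (auto simp: Let_def)
qed simp

text \<open>Block \<open>(a, b)\<close> of the triple product is a sum over the frequencies in which
  \<open>a\<close> and \<open>b\<close> enter only through a power of the root with exponent
  \<open>a - b\<close> modulo \<open>p\<close>. Hence it is block circulant, with the inverse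
  transform of the given blocks as its slices.\<close>

lemma fourier_block_diag_eq_bcirc:
  assumes p: "0 < length Ds" and Ds: "\<forall>D\<in>set Ds. D \<in> carrier_mat m n"
  shows "fourier_block_diag m n Ds = bcirc (tidft m n (length Ds) (\<lambda>l. map_mat complex_of_real (Ds ! l)))"
    (is "?L = bcirc ?S")
proof -
  define p where "p = length Ds"
  define E where "E = map (map_mat complex_of_real) Ds"
  define F where "F = fourier_mat p"
  let ?w = "root_of_unity p"
  have p0: "0 < p" using p by (simp add: p_def)
  have S: "?S \<in> carrier_tensor m n p" by (simp add: p_def)
  have E: "\<forall>D\<in>set E. D \<in> carrier_mat m n" "length E = p" using Ds by (auto simp: E_def p_def)
  have "sum_list (map dim_row E) = m * length E" "sum_list (map dim_col E) = n * length E"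
    using E(1) by (induction E) auto
  hence dimE: "dim_row (diag_block_mat E) = m * p" "dim_col (diag_block_mat E) = n * p"
    by (simp_all add: dim_diag_block_mat E)
  have dimF[simp]: "dim_row F = p" "dim_col F = p" by (simp_all add: F_def fourier_mat_def)
  have L: "?L = kronecker F (1\<^sub>m m) * diag_block_mat E * kronecker (mat_adjoint F) (1\<^sub>m n)"
    by (simp add: fourier_block_diag_def Let_def F_def p_def E_def)
  have K: "kronecker G (1\<^sub>m k) $$ (a * k + r, b * k + c) = G $$ (a, b) * (if r = c then 1 else 0)"
    if "a < p" "b < p" "r < k" "c < k" "dim_row G = p" "dim_col G = p" for G :: "complex mat" and a b r c k
    using that block_index_less[of a p r k] block_index_less[of b p c k] by (simp add: kronecker_def mult.commute)
  have dimK[simp]: "dim_row (kronecker G (1\<^sub>m k)) = k * p" "dim_col (kronecker G (1\<^sub>m k)) = k * p"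
    if "dim_row G = p" "dim_col G = p" for G :: "complex mat" and k
    using that by (simp_all add: kronecker_def)
  have KE: "(kronecker F (1\<^sub>m m) * diag_block_mat E) $$ (a * m + r, b * n + c) = F $$ (a, b) * E ! b $$ (r, c)"
    if ab: "a < p" "b < p" and rc: "r < m" "c < n" for a b r c
  proof -
    have "(kronecker F (1\<^sub>m m) * diag_block_mat E) $$ (a * m + r, b * n + c) =
        (\<Sum>x<m * p. kronecker F (1\<^sub>m m) $$ (a * m + r, x) * diag_block_mat E $$ (x, b * n + c))"
      using that dimE block_index_less[of a p r m] block_index_less[of b p c n]
      by (simp add: scalar_prod_def atLeast0LessThan)
    \<comment> \<open>The Kronecker factor leaves only \<open>t = r\<close>, the block diagonal
      factor only \<open>l = b\<close>.\<close>
    also have "\<dots> = (\<Sum>l<p. \<Sum>t<m. if t = r then if l = b then F $$ (a, b) * E ! b $$ (r, c) else 0 else 0)"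
      unfolding sum_blocks using that E
      by (intro sum.cong refl) (auto simp: K diag_block_mat_index)
    finally show ?thesis using that by simp
  qed
  have entry: "?L $$ (a * m + r, b * n + c) = bcirc ?S $$ (a * m + r, b * n + c)"
    if ab: "a < p" "b < p" and rc: "r < m" "c < n" for a b r c
  proof -
    have "?L $$ (a * m + r, b * n + c) = (\<Sum>x<n * p. (kronecker F (1\<^sub>m m) * diag_block_mat E) $$ (a * m + r, x)
        * kronecker (mat_adjoint F) (1\<^sub>m n) $$ (x, b * n + c))"
      unfolding L using that dimE block_index_less[of a p r m] block_index_less[of b p c n]
      by (subst index_mult_mat) (simp_all add: scalar_prod_def atLeast0LessThan del: index_mult_mat(1))
    also have "\<dots> = (\<Sum>l<p. \<Sum>t<n. if t = c then F $$ (a, l) * E ! l $$ (r, c) * cnj (F $$ (b, l)) else 0)"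
      unfolding sum_blocks using that
      by (intro sum.cong refl) (auto simp: K KE simp del: index_mult_mat(1))
    also have "\<dots> = (\<Sum>l<p. F $$ (a, l) * E ! l $$ (r, c) * cnj (F $$ (b, l)))" using rc by simp
    also have "\<dots> = (\<Sum>l<p. ?w ^ (l * ((a + p - b) mod p)) * E ! l $$ (r, c) / of_nat p)"
    proof (intro sum.cong refl)
      fix l assume l: "l \<in> {..<p}"
      \<comment> \<open>One factor \<open>1 / sqrt p\<close> comes from each Fourier matrix;
        together they form the \<open>1 / p\<close> of \<open>tidft\<close>.\<close>
      have sq: "complex_of_real (sqrt (real p)) * complex_of_real (sqrt (real p)) = of_nat p"
        by (simp flip: of_real_mult)
      have F: "F $$ (a, l) = ?w ^ (a * l) / complex_of_real (sqrt (real p))"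
        "F $$ (b, l) = ?w ^ (b * l) / complex_of_real (sqrt (real p))"
        using ab l by (simp_all add: F_def fourier_mat_def root_of_unity_def)
      show "F $$ (a, l) * E ! l $$ (r, c) * cnj (F $$ (b, l)) = ?w ^ (l * ((a + p - b) mod p)) * E ! l $$ (r, c) / of_nat p"
        unfolding F sq[symmetric] mult.commute[of l] root_of_unity_diff[OF ab(2)] by simp
    qed
    also have "\<dots> = bcirc ?S $$ (a * m + r, b * n + c)"
      unfolding bcirc_index[OF S ab rc] using that p0
      by (simp add: tidft_def E_def p_def[symmetric] flip: sum_divide_distrib)
    finally show ?thesis .
  qed
  show ?thesis
  proof (rule eq_matI)
    fix x y assume "x < dim_row (bcirc ?S)" "y < dim_col (bcirc ?S)"
    hence "x < m * p" "y < n * p" using bcirc_dim[OF S p0] by auto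
    thus "?L $$ (x, y) = bcirc ?S $$ (x, y)" using entry by (metis block_index_cases)
  qed (use bcirc_dim[OF S p0] in \<open>simp_all add: L\<close>)
qed

section \<open>Generalized tensor functions in the Fourier domain\<close>

lemma bcirc_eq_fourier_block_diag_iff:
  assumes S: "S \<in> carrier_tensor m n (length Ds)" and p: "0 < length Ds"
    and Ds: "\<forall>D\<in>set Ds. D \<in> carrier_mat m n"
  shows "bcirc S = fourier_block_diag m n Ds \<longleftrightarrow>
    S = tidft m n (length Ds) (\<lambda>l. map_mat complex_of_real (Ds ! l))"
  unfolding fourier_block_diag_eq_bcirc[OF p Ds]
  by (rule inj_on_eq_iff[OF bcirc_inj_on[OF p] S tidft_carrier])

text \<open>The matrix under \<open>bcirc_inv\<close> lies in the image of \<open>bcirc\<close>,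
  where the \<open>inv_into\<close> is a true inverse by injectivity.\<close>

lemma fhat_eq_tidft:
  assumes p: "0 < length Ds" and Ds: "\<forall>D\<in>set Ds. D \<in> carrier_mat m n"
  shows "fhat f m n Ds = tidft m n (length Ds) (\<lambda>l. map_mat complex_of_real (map (ftilde f) Ds ! l))"
proof -
  have "fourier_block_diag m n (map (ftilde f) Ds) =
      bcirc (tidft m n (length Ds) (\<lambda>l. map_mat complex_of_real (map (ftilde f) Ds ! l)))"
    using fourier_block_diag_eq_bcirc[of "map (ftilde f) Ds" m n] p Ds by simp
  thus ?thesis
    unfolding fhat_def bcirc_inv_def by (simp only: inv_into_f_f[OF bcirc_inj_on[OF p] tidft_carrier])
qed

lemma tdft_usv:
  assumes U: "U \<in> carrier_tensor n n p" and S: "S \<in> carrier_tensor n n p"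
    and V: "V \<in> carrier_tensor n n p" and p: "0 < p"
  shows "tdft n n (U \<star> S \<star> tadjoint V) j = tdft n n U j * tdft n n S j * mat_adjoint (tdft n n V j)"
  unfolding tdft_tprod[OF tprod_carrier[OF U S p] tadjoint_carrier[OF V p] p] tdft_tprod[OF U S p]
    tdft_tadjoint[OF V p] ..

text \<open>A T-SVD and a choice of one matrix decomposition at each frequency are the same data:
  the transform reads the matrices off a T-SVD, and \<open>tidft\<close> assembles a T-SVD from
  them. Existence and uniqueness thus become questions about single matrices.\<close>

lemma gtf_value_iff:
  assumes A: "A \<in> carrier_tensor n n p" and p: "0 < p"
  shows "gtf_value f A X \<longleftrightarrow>
    X \<in> carrier_tensor n n p \<and> (\<forall>j<p. svd_value f n (tdft n n A j) (tdft n n X j))"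
proof (intro iffI conjI allI impI)
  note sz = tnrows_carrier[OF A p] tncols_carrier[OF A p] carrier_tensorD(1)[OF A]
  let ?c = "map_mat complex_of_real"
  assume "gtf_value f A X"
  then obtain U S V Ds where svd: "is_tsvd A U S V Ds" and X: "X = U \<star> fhat f n n Ds \<star> tadjoint V"
    by (auto simp: gtf_value_def sz)
  have U: "U \<in> carrier_tensor n n p" "\<And>j. j < p \<Longrightarrow> unitary_mat n (tdft n n U j)"
    and V: "V \<in> carrier_tensor n n p" "\<And>j. j < p \<Longrightarrow> unitary_mat n (tdft n n V j)"
    and S: "S \<in> carrier_tensor n n p" and AU: "A = U \<star> S \<star> tadjoint V"
    and len: "length Ds = p" and Ds: "\<forall>D\<in>set Ds. nonneg_diag n D"
    and bS: "bcirc S = fourier_block_diag n n Ds"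
    using svd tunitary_iff[OF p] by (auto simp: is_tsvd_def sz Let_def nonneg_diag_def)
  have Dsc: "\<forall>D\<in>set Ds. D \<in> carrier_mat n n" using Ds by (simp add: nonneg_diag_def)
  have St: "S = tidft n n p (\<lambda>l. ?c (Ds ! l))"
    using bcirc_eq_fourier_block_diag_iff[of S n n Ds] S p Dsc bS len by simp
  have Ft: "fhat f n n Ds = tidft n n p (\<lambda>l. ?c (map (ftilde f) Ds ! l))"
    using fhat_eq_tidft[of Ds n n f] p Dsc len by simp
  show "X \<in> carrier_tensor n n p"
    unfolding X Ft by (rule tprod_carrier[OF tprod_carrier[OF U(1) tidft_carrier p] tadjoint_carrier[OF V(1) p] p])
  fix j assume j: "j < p"
  have D: "nonneg_diag n (Ds ! j)" using Ds j len by simp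
  hence Dc: "Ds ! j \<in> carrier_mat n n" by (simp add: nonneg_diag_def)
  have "is_svd n (tdft n n A j) (tdft n n U j) (Ds ! j) (tdft n n V j)"
    using U(2)[OF j] V(2)[OF j] D Dc j
    unfolding AU tdft_usv[OF U(1) S V(1) p] by (simp add: is_svd_def St tdft_tidft)
  moreover have "tdft n n X j = tdft n n U j * ?c (ftilde f (Ds ! j)) * mat_adjoint (tdft n n V j)"
    unfolding X Ft tdft_usv[OF U(1) tidft_carrier V(1) p] using j len Dc by (simp add: tdft_tidft)
  ultimately show "svd_value f n (tdft n n A j) (tdft n n X j)" by (auto simp: svd_value_def)
next
  note sz = tnrows_carrier[OF A p] tncols_carrier[OF A p] carrier_tensorD(1)[OF A]
  let ?c = "map_mat complex_of_real"
  assume X: "X \<in> carrier_tensor n n p \<and> (\<forall>j<p. svd_value f n (tdft n n A j) (tdft n n X j))"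
  \<comment> \<open>The decompositions may be chosen independently at each frequency, since the
    factors of the T-SVD are complex tensors.\<close>
  then obtain U D V where UDV: "\<And>j. j < p \<Longrightarrow> is_svd n (tdft n n A j) (U j) (D j) (V j)"
    "\<And>j. j < p \<Longrightarrow> tdft n n X j = U j * ?c (ftilde f (D j)) * mat_adjoint (V j)"
    unfolding svd_value_def by metis
  have c: "U j \<in> carrier_mat n n" "V j \<in> carrier_mat n n" "D j \<in> carrier_mat n n"
    "unitary_mat n (U j)" "unitary_mat n (V j)" "nonneg_diag n (D j)" if "j < p" for j
    using UDV(1)[OF that] by (auto simp: is_svd_def unitary_mat_def nonneg_diag_def)
  define Ut Vt St where "Ut = tidft n n p U" and "Vt = tidft n n p V" and "St = tidft n n p (\<lambda>j. ?c (D j))"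
  define Ds where "Ds = map D [0..<p]"
  have Ds: "length Ds = p" "\<forall>D\<in>set Ds. D \<in> carrier_mat n n" "\<forall>D\<in>set Ds. nonneg_diag n D"
    using c by (auto simp: Ds_def)
  have car: "Ut \<in> carrier_tensor n n p" "Vt \<in> carrier_tensor n n p" "St \<in> carrier_tensor n n p"
    by (simp_all add: Ut_def Vt_def St_def)
  have dft: "tdft n n Ut j = U j" "tdft n n Vt j = V j" "tdft n n St j = ?c (D j)" if "j < p" for j
    using c that by (simp_all add: Ut_def Vt_def St_def tdft_tidft)
  have uni: "tunitary n p Ut" "tunitary n p Vt"
    using tunitary_iff[OF p] car c dft by simp_all
  \<comment> \<open>The inverse transform works entrywise, so off-diagonal zeros at all frequencies
    give diagonal slices.\<close>
  have "?c (D l) $$ (r, s) = 0" if "l < p" "r < n" "s < n" "r \<noteq> s" for l r s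
    using c(3,6)[OF that(1)] that(2-) by (auto simp: nonneg_diag_def diagonal_mat_def)
  hence "F_diagonal St"
    by (auto simp: F_diagonal_def St_def tidft_def diagonal_mat_def)
  moreover have "A = Ut \<star> St \<star> tadjoint Vt"
  proof (rule tdft_eqI[OF A])
    show "Ut \<star> St \<star> tadjoint Vt \<in> carrier_tensor n n p"
      using car p by (intro tprod_carrier tadjoint_carrier)
    show "tdft n n A j = tdft n n (Ut \<star> St \<star> tadjoint Vt) j" if "j < p" for j
      using UDV(1)[OF that] that by (simp add: tdft_usv[OF car(1,3,2) p] dft is_svd_def)
  qed
  moreover have "bcirc St = fourier_block_diag n n Ds"
    using bcirc_eq_fourier_block_diag_iff[of St n n Ds] car(3) p Ds
    by (simp add: St_def tidft_def) (simp add: Ds_def)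
  ultimately have "is_tsvd A Ut St Vt Ds"
    unfolding is_tsvd_def sz Let_def using uni car Ds by (simp add: nonneg_diag_def)
  moreover have "X = Ut \<star> fhat f n n Ds \<star> tadjoint Vt"
  proof -
    have Ft: "fhat f n n Ds = tidft n n p (\<lambda>l. ?c (map (ftilde f) Ds ! l))"
      using fhat_eq_tidft[of Ds n n f] p Ds by simp
    show ?thesis
    proof (rule tdft_eqI[OF conjunct1[OF X]])
      show "Ut \<star> fhat f n n Ds \<star> tadjoint Vt \<in> carrier_tensor n n p"
        unfolding Ft
        by (rule tprod_carrier[OF tprod_carrier[OF car(1) tidft_carrier p] tadjoint_carrier[OF car(2) p] p])
      show "tdft n n X j = tdft n n (Ut \<star> fhat f n n Ds \<star> tadjoint Vt) j" if "j < p" for j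
        unfolding Ft tdft_usv[OF car(1) tidft_carrier car(2) p] using UDV(2)[OF that] that c(3)
        by (simp add: dft tdft_tidft Ds_def)
    qed
  qed
  ultimately show "gtf_value f A X" unfolding gtf_value_def sz by blast
qed

lemma gtf_value_exists:
  assumes A: "A \<in> carrier_tensor n n p" and p: "0 < p"
  shows "\<exists>X. gtf_value f A X"
proof -
  obtain Y where Y: "\<And>j. svd_value f n (tdft n n A j) (Y j)"
    using svd_value_exists[OF tdft_carrier] by metis
  have "tdft n n (tidft n n p Y) j = Y j" if "j < p" for j
    using tdft_tidft[OF svd_value_carrier[OF Y] that] .
  hence "gtf_value f A (tidft n n p Y)" using Y by (simp add: gtf_value_iff[OF A p])
  thus ?thesis ..
qed

lemma gtf_value_unique:
  assumes A: "A \<in> carrier_tensor n n p" and p: "0 < p" and X: "gtf_value f A X" and Y: "gtf_value f A Y"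
  shows "X = Y"
proof (rule tdft_eqI)
  show "X \<in> carrier_tensor n n p" "Y \<in> carrier_tensor n n p"
    using X Y by (simp_all add: gtf_value_iff[OF A p])
  show "tdft n n X j = tdft n n Y j" if "j < p" for j
    using X Y that svd_value_unique by (auto simp: gtf_value_iff[OF A p])
qed

lemma gtf_well_defined:
  assumes "A \<in> carrier_tensor n n p" and "0 < p"
  shows "gtf_well_defined f A"
  unfolding gtf_well_defined_def using gtf_value_exists[OF assms] gtf_value_unique[OF assms] by blast

text \<open>The unitary matrix whose conjugation block-diagonalizes \<open>\<Phi>(B + \<i>C)\<close> to \<open>diag(B + \<i>C, B - \<i>C)\<close>.\<close>
definition split_mat :: "nat \<Rightarrow> complex mat" where
  "split_mat n = four_block_mat (of_real (1 / sqrt 2) \<cdot>\<^sub>m 1\<^sub>m n) (- \<i> * of_real (1 / sqrt 2) \<cdot>\<^sub>m 1\<^sub>m n)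
     (- \<i> * of_real (1 / sqrt 2) \<cdot>\<^sub>m 1\<^sub>m n) (of_real (1 / sqrt 2) \<cdot>\<^sub>m 1\<^sub>m n)"

lemma split_mat_carrier: "split_mat n \<in> carrier_mat (n + n) (n + n)"
  by (simp add: split_mat_def)

lemma mat_adjoint_split_mat:
  "mat_adjoint (split_mat n) =
    four_block_mat (of_real (1 / sqrt 2) \<cdot>\<^sub>m 1\<^sub>m n) (\<i> * of_real (1 / sqrt 2) \<cdot>\<^sub>m 1\<^sub>m n)
     (\<i> * of_real (1 / sqrt 2) \<cdot>\<^sub>m 1\<^sub>m n) (of_real (1 / sqrt 2) \<cdot>\<^sub>m 1\<^sub>m n)"
  by (rule eq_matI) (auto simp: split_mat_def)

text \<open>For \<open>M = B + \<i>C\<close> and \<open>N = B - \<i>C\<close> the right side is the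
  block matrix of \<open>B\<close> and \<open>C\<close>. \<open>M\<close> and \<open>N\<close> are
  left independent because at frequency \<open>j\<close> the second block is the conjugate of the
  transform at \<open>-j\<close>, not at \<open>j\<close>.\<close>

lemma split_mat_conj:
  assumes M: "M \<in> carrier_mat n n" and N: "N \<in> carrier_mat n n"
  shows "split_mat n * four_block_mat M (0\<^sub>m n n) (0\<^sub>m n n) N * mat_adjoint (split_mat n) =
    four_block_mat ((1 / 2) \<cdot>\<^sub>m (M + N)) ((\<i> / 2) \<cdot>\<^sub>m (M - N)) ((- \<i> / 2) \<cdot>\<^sub>m (M - N)) ((1 / 2) \<cdot>\<^sub>m (M + N))"
proof -
  \<comment> \<open>\<open>c\<close> and \<open>d\<close> are the scalars in
    \<open>split_mat\<close>; \<open>c\<close> and \<open>e\<close> are those in its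
    adjoint.\<close>
  define c d where "c = complex_of_real (1 / sqrt 2)" and "d = - \<i> * c"
  define e where "e = \<i> * c"
  have sq: "complex_of_real (1 / sqrt 2) * complex_of_real (1 / sqrt 2) = 1 / 2"
    unfolding of_real_mult[symmetric] by simp
  have cc: "c * (c * x) = x / 2" for x
    using sq unfolding c_def by (metis mult.assoc mult.commute times_divide_eq_right mult.right_neutral)
  have cde: "c * (c * x) = x / 2" "e * (d * x) = x / 2" "e * (c * x) = \<i> * x / 2"
    "c * (d * x) = - \<i> * x / 2" for x
    unfolding d_def e_def using cc[of x] cc[of "\<i> * x"] by (simp_all add: mult_ac)
  have sm: "(x \<cdot>\<^sub>m 1\<^sub>m n) * K = x \<cdot>\<^sub>m K" "K * (x \<cdot>\<^sub>m 1\<^sub>m n) = x \<cdot>\<^sub>m K" if "K \<in> carrier_mat n n" for x and K :: "complex mat"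
    using that by (simp_all add: mult_smult_assoc_mat[of _ n n _ n] mult_smult_distrib[of _ n n _ n])
  have zz: "x \<cdot>\<^sub>m (0\<^sub>m n n :: complex mat) = 0\<^sub>m n n" for x by (rule eq_matI) auto
  have "split_mat n * four_block_mat M (0\<^sub>m n n) (0\<^sub>m n n) N =
      four_block_mat (c \<cdot>\<^sub>m M) (d \<cdot>\<^sub>m N) (d \<cdot>\<^sub>m M) (c \<cdot>\<^sub>m N)"
    unfolding split_mat_def c_def[symmetric] d_def[symmetric]
    using M N by (simp add: mult_four_block_mat[of _ n n _ n _ n _ _ n _ n] sm zz)
  also have "\<dots> * mat_adjoint (split_mat n) =
      four_block_mat (c \<cdot>\<^sub>m (c \<cdot>\<^sub>m M) + e \<cdot>\<^sub>m (d \<cdot>\<^sub>m N)) (e \<cdot>\<^sub>m (c \<cdot>\<^sub>m M) + c \<cdot>\<^sub>m (d \<cdot>\<^sub>m N))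
        (c \<cdot>\<^sub>m (d \<cdot>\<^sub>m M) + e \<cdot>\<^sub>m (c \<cdot>\<^sub>m N)) (e \<cdot>\<^sub>m (d \<cdot>\<^sub>m M) + c \<cdot>\<^sub>m (c \<cdot>\<^sub>m N))"
    unfolding mat_adjoint_split_mat c_def[symmetric] e_def[symmetric]
    using M N by (simp add: mult_four_block_mat[of _ n n _ n _ n _ _ n _ n] sm)
  also have "\<dots> = four_block_mat ((1 / 2) \<cdot>\<^sub>m (M + N)) ((\<i> / 2) \<cdot>\<^sub>m (M - N)) ((- \<i> / 2) \<cdot>\<^sub>m (M - N)) ((1 / 2) \<cdot>\<^sub>m (M + N))"
  proof (rule cong_four_block_mat)
    show "c \<cdot>\<^sub>m (c \<cdot>\<^sub>m M) + e \<cdot>\<^sub>m (d \<cdot>\<^sub>m N) = (1 / 2) \<cdot>\<^sub>m (M + N)"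
      "e \<cdot>\<^sub>m (d \<cdot>\<^sub>m M) + c \<cdot>\<^sub>m (c \<cdot>\<^sub>m N) = (1 / 2) \<cdot>\<^sub>m (M + N)"
      "e \<cdot>\<^sub>m (c \<cdot>\<^sub>m M) + c \<cdot>\<^sub>m (d \<cdot>\<^sub>m N) = (\<i> / 2) \<cdot>\<^sub>m (M - N)"
      "c \<cdot>\<^sub>m (d \<cdot>\<^sub>m M) + e \<cdot>\<^sub>m (c \<cdot>\<^sub>m N) = (- \<i> / 2) \<cdot>\<^sub>m (M - N)"
      using M N by (auto intro!: eq_matI simp: cde right_diff_distrib diff_divide_distrib add_divide_distrib)
  qed
  finally show ?thesis .
qed

text \<open>The middle factor in \<open>split_mat_conj\<close> is the identity for
  \<open>M = N = 1\<close>; the inverse on the other side follows because the matrices are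
  square.\<close>

lemma unitary_split_mat: "unitary_mat (n + n) (split_mat n)"
proof -
  have "split_mat n * mat_adjoint (split_mat n) = 1\<^sub>m (n + n)"
    using split_mat_conj[of "1\<^sub>m n" n "1\<^sub>m n"] split_mat_carrier[of n]
    by simp (rule eq_matI, auto)
  thus ?thesis
    using split_mat_carrier[of n] mat_mult_left_right_inverse[OF split_mat_carrier mat_adjoint_carrier[OF split_mat_carrier]]
    by (simp add: unitary_mat_def)
qed

section \<open>Real tensors and the transform of \<open>Phi\<close>\<close>

lemma tensor_of_real_carrier: "X \<in> carrier_tensor m n p \<Longrightarrow> tensor_of_real X \<in> carrier_tensor m n p"
  by (auto simp: tensor_of_real_def carrier_tensor_def)

lemma tensor_of_real_inj: "tensor_of_real X = tensor_of_real Y \<Longrightarrow> X = Y"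
  unfolding tensor_of_real_def by (rule map_inj_on) (auto simp: inj_on_def dest: of_real_hom.mat_hom_inj)

text \<open>Conjugating the transform at \<open>-j\<close> gives the transform at \<open>j\<close>
  of the conjugate tensor. Half sums and differences with the transform of \<open>X\<close> itself
  are the transforms of the real and imaginary parts, which are the blocks of
  \<open>Phi X\<close>.\<close>

lemma tdft_Phi:
  assumes X: "X \<in> carrier_tensor n n p" and j: "j < p"
  shows "tdft (n + n) (n + n) (tensor_of_real (Phi X)) j =
    split_mat n * four_block_mat (tdft n n X j) (0\<^sub>m n n) (0\<^sub>m n n)
      (map_mat cnj (tdft n n X ((p - j) mod p))) * mat_adjoint (split_mat n)"
proof -
  let ?z = "cnj (root_of_unity p)"
  note len = carrier_tensorD(1)[OF X]
  have lenP: "length (tensor_of_real (Phi X)) = p"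
    by (simp add: tensor_of_real_def Phi_def block_tensor_def len)
  have dims: "dim_row (X ! k) = n" "dim_col (X ! k) = n" if "k < p" for k
    using carrier_tensorD(2)[OF X that] by auto
  have N: "cnj (tdft n n X ((p - j) mod p) $$ (r, c)) = (\<Sum>k<p. ?z ^ (j * k) * cnj (X ! k $$ (r, c)))"
    if "r < n" "c < n" for r c
    using that j len root_of_unity_reverse[of j p] by (simp add: tdft_def)
  have M: "tdft n n X j $$ (r, c) = (\<Sum>k<p. ?z ^ (j * k) * X ! k $$ (r, c))" if "r < n" "c < n" for r c
    using that len by (simp add: tdft_def)
  have P: "tdft (n + n) (n + n) (tensor_of_real (Phi X)) j $$ (r, c) = (\<Sum>k<p. ?z ^ (j * k) *
      of_real (four_block_mat (map_mat Re (X ! k)) (- map_mat Im (X ! k)) (map_mat Im (X ! k)) (map_mat Re (X ! k)) $$ (r, c)))"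
    if "r < n + n" "c < n + n" for r c
    using that lenP len dims by (simp add: tdft_def) (simp add: tensor_of_real_def Phi_def block_tensor_def)
  have re: "(\<Sum>k<p. ?z ^ (j * k) * complex_of_real (Re (x k))) =
      1 / 2 * ((\<Sum>k<p. ?z ^ (j * k) * x k) + (\<Sum>k<p. ?z ^ (j * k) * cnj (x k)))" for x
    unfolding sum.distrib[symmetric] sum_distrib_left[of "1 / 2"]
    by (rule sum.cong) (simp_all add: complex_add_cnj flip: distrib_left)
  have Im_cnj: "complex_of_real (Im y) = - \<i> / 2 * (y - cnj y)" for y
    by (simp add: complex_eq_iff)
  have im: "(\<Sum>k<p. ?z ^ (j * k) * complex_of_real (Im (x k))) =
      - \<i> / 2 * ((\<Sum>k<p. ?z ^ (j * k) * x k) - (\<Sum>k<p. ?z ^ (j * k) * cnj (x k)))" for x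
    unfolding sum_subtractf[symmetric] sum_distrib_left[of "- \<i> / 2"]
    by (rule sum.cong) (simp_all add: Im_cnj algebra_simps)
  show ?thesis
    unfolding split_mat_conj[OF tdft_carrier map_carrier_mat[THEN iffD2, OF tdft_carrier]]
  proof (rule eq_matI, goal_cases)
    case (1 r c)
    hence rc: "r < n + n" "c < n + n" by auto
    show ?case
      unfolding P[OF rc]
      using rc dims by (cases "r < n"; cases "c < n")
        (simp_all add: M N re im sum_negf)
  qed auto
qed

lemma gtf_value_Phi:
  assumes A: "A \<in> carrier_tensor n n p" and p: "0 < p" and X: "gtf_value f A X"
  shows "gtf_value f (tensor_of_real (Phi A)) (tensor_of_real (Phi X))"
proof -
  have Xc: "X \<in> carrier_tensor n n p" and sv: "\<And>j. j < p \<Longrightarrow> svd_value f n (tdft n n A j) (tdft n n X j)"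
    using X by (auto simp: gtf_value_iff[OF A p])
  have car: "tensor_of_real (Phi Y) \<in> carrier_tensor (n + n) (n + n) p" if "Y \<in> carrier_tensor n n p" for Y
    using tensor_of_real_carrier[OF Phi_carrier[OF that]] by (simp add: mult_2)
  have "svd_value f (n + n) (tdft (n + n) (n + n) (tensor_of_real (Phi A)) j) (tdft (n + n) (n + n) (tensor_of_real (Phi X)) j)"
    if j: "j < p" for j
  proof -
    \<comment> \<open>The second block needs the decomposition at the reflected frequency; reduction
      modulo \<open>p\<close> sends frequency 0 to itself.\<close>
    have "(p - j) mod p < p" using p by simp
    from svd_value_conj[OF svd_value_four_block_diag[OF sv[OF j] svd_value_cnj[OF sv[OF this]]] unitary_split_mat unitary_split_mat]
    show ?thesis unfolding tdft_Phi[OF A j] tdft_Phi[OF Xc j] .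
  qed
  thus ?thesis unfolding gtf_value_iff[OF car[OF A] p] using car[OF Xc] by simp
qed

theorem theorem13:
  fixes n p :: nat
    and A :: "complex tensor"
    and B C :: "real tensor"
    and f :: "real \<Rightarrow> real"
  assumes "0 < n" and "0 < p"
    and "B \<in> carrier_tensor n n p" and "C \<in> carrier_tensor n n p"
    and "A = cart_tensor B C"
    and "f 0 = 0"
  shows "gtf_well_defined f A
    \<and> gtf_real_well_defined f (Phi A)
    \<and> gtf_real f (Phi A) = Phi (gtf f A)"
proof -
  note p = assms(2)
  have A: "A \<in> carrier_tensor n n p"
    using assms(3,4) unfolding assms(5) carrier_tensor_def cart_tensor_def
    by (auto simp: set_zip subset_iff)
  have P: "tensor_of_real (Phi A) \<in> carrier_tensor (2 * n) (2 * n) p"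
    by (rule tensor_of_real_carrier[OF Phi_carrier[OF A]])
  have wd: "gtf_well_defined f A" by (rule gtf_well_defined[OF A p])
  hence "gtf_value f A (gtf f A)"
    unfolding gtf_well_defined_def gtf_def by (rule theI')
  hence val: "gtf_value f (tensor_of_real (Phi A)) (tensor_of_real (Phi (gtf f A)))"
    by (rule gtf_value_Phi[OF A p])
  \<comment> \<open>Realness comes from uniqueness: one value is already known to be real, so no
    real T-SVD has to be constructed.\<close>
  have uniq: "Z = tensor_of_real (Phi (gtf f A))" if "gtf_value f (tensor_of_real (Phi A)) Z" for Z
    using gtf_value_unique[OF P p that val] .
  have "gtf_real_well_defined f (Phi A)"
    unfolding gtf_real_well_defined_def using gtf_well_defined[OF P p] uniq by blast
  moreover have "gtf_real f (Phi A) = Phi (gtf f A)"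
    \<comment> \<open>Injectivity of \<open>tensor_of_real\<close> carries uniqueness back to real
      tensors.\<close>
    unfolding gtf_real_def by (rule the_equality) (use val uniq tensor_of_real_inj in blast)+
  ultimately show ?thesis using wd by blast
qed

end
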